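(* Let $M, P$ be finite dimensional $C^*$-algebras and let $\Phi\colon M\to P$ be a positive unital trace preserving linear map. Let $e_1,\dots,e_n$ be projections in $M$ with $\sum_{i=1}^n e_i=1$ such that $\Phi(e_i)$ is a projection for each $i$. Let $M_i=e_iMe_i$ and let $\Phi_i=\Phi|_{M_i}\colon M_i\to \Phi(e_i)P\Phi(e_i)$ be the restriction of $\Phi$ to $M_i$. Then $$C(\Phi)=\log\sum_{i=1}^n e^{C(\Phi_i)},$$ where $C(\cdot)$ denotes capacity.
   Context: For a finite dimensional $C^*$-algebra $P$, $\mathrm{Tr}_P$ denotes the trace on $P$ taking the value $1$ at each minimal projection of $P$. A linear map $\Phi\colon M\to P$ between finite dimensional $C^*$-algebras is trace preserving if $\mathrm{Tr}_P(\Phi(x))=\mathrm{Tr}_M(x)$ for all $x\in M$. "Positive" means that positive elements are mapped to positive elements (complete positivity is not assumed). Let $\eta(t)=-t\log t$ for $t>0$ and $\eta(0)=0$, with $\log$ the natural logarithm. The entropy of a positive operator $a\in P$ is $S(a)=\mathrm{Tr}_P(\eta(a))$. Capacity: for a positive unital trace preserving map $\Phi\colon M\to P$, let $C$ be the set of positive $a\in M$ with $\mathrm{Tr}_M(a)=1$. For $a\in C$ put $$C(\Phi,a)=\sup\Big( S(\Phi(a))-\sum_i\lambda_iS(\Phi(a_i))\Big),$$ the supremum being over all (finite) convex combinations $\sum_i\lambda_ia_i=a$ with $a_i\in C$, $\lambda_i\ge0$, $\sum_i\lambda_i=1$. The capacity of $\Phi$ is $C(\Phi)=\sup_{a\in C}C(\Phi,a)$.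 The algebra $M_i=e_iMe_i$ has unit $e_i$, and $\Phi(e_i)P\Phi(e_i)$ has unit $\Phi(e_i)$; $\Phi_i$ is a positive unital trace preserving map between these algebras, and $C(\Phi_i)$ is its capacity. *)

theory Defs
  imports "HOL-Analysis.Analysis" "HOL-Library.Extended_Real" "HOL-Library.FuncSet"
begin

(* Unital C*-algebras. The class ring_1 is avoided because it demands 0 \<noteq> 1, which would
   exclude the zero algebra; real_normed_algebra + monoid_mult admits it. *)
class cstar_algebra = banach + real_normed_algebra + monoid_mult +
  fixes scaleC :: "complex \<Rightarrow> 'a \<Rightarrow> 'a" (infixr "*\<^sub>C" 75)
    and star :: "'a \<Rightarrow> 'a"
  assumes scaleC_add_right: "c *\<^sub>C (x + y) = c *\<^sub>C x + c *\<^sub>C y"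
    and scaleC_add_left: "(c + d) *\<^sub>C x = c *\<^sub>C x + d *\<^sub>C x"
    and scaleC_scaleC: "c *\<^sub>C d *\<^sub>C x = (c * d) *\<^sub>C x"
    and scaleR_scaleC: "scaleR r x = complex_of_real r *\<^sub>C x"
    and mult_scaleC_left: "(c *\<^sub>C x) * y = c *\<^sub>C (x * y)"
    and mult_scaleC_right: "x * (c *\<^sub>C y) = c *\<^sub>C (x * y)"
    and norm_scaleC: "norm (c *\<^sub>C x) = cmod c * norm x"
    and star_star: "star (star x) = x"
    and star_add: "star (x + y) = star x + star y"
    and star_scaleC: "star (c *\<^sub>C x) = cnj c *\<^sub>C star x"
    and star_mult: "star (x * y) = star y * star x"
    and norm_star_mult_self: "norm (star x * x) = (norm x)\<^sup>2"

class fd_cstar_algebra = cstar_algebra +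
  assumes finite_dimensional: "\<exists>B. finite B \<and> (\<forall>x. \<exists>c. x = (\<Sum>b\<in>B. c b *\<^sub>C b))"

definition projection :: "'a::cstar_algebra \<Rightarrow> bool" where
  "projection p \<longleftrightarrow> star p = p \<and> p * p = p"

(* For a projection e, corner e is the C*-algebra e A e with unit e, where A is the whole type;
   the whole algebra is corner 1. All notions below are relative to the algebra corner e. *)
definition corner :: "'a::cstar_algebra \<Rightarrow> 'a set" where
  "corner e = {e * x * e | x. True}"

lemma corner_one [simp]: "corner (1::'a::cstar_algebra) = UNIV"
  by (auto simp: corner_def)

definition positive_in :: "'a::cstar_algebra \<Rightarrow> 'a \<Rightarrow> bool" where
  "positive_in e a \<longleftrightarrow> (\<exists>b\<in>corner e. a = star b * b)"

(* q * p = q is the usual order q \<le> p of projections. *)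
definition minimal_projection_in :: "'a::cstar_algebra \<Rightarrow> 'a \<Rightarrow> bool" where
  "minimal_projection_in e p \<longleftrightarrow> p \<in> corner e \<and> projection p \<and> p \<noteq> 0 \<and>
     (\<forall>q\<in>corner e. projection q \<and> q * p = q \<longrightarrow> q = 0 \<or> q = p)"

definition is_trace_on :: "'a::cstar_algebra \<Rightarrow> ('a \<Rightarrow> complex) \<Rightarrow> bool" where
  "is_trace_on e t \<longleftrightarrow>
     (\<forall>x\<in>corner e. \<forall>y\<in>corner e. t (x + y) = t x + t y) \<and>
     (\<forall>c. \<forall>x\<in>corner e. t (c *\<^sub>C x) = c * t x) \<and>
     (\<forall>x\<in>corner e. \<forall>y\<in>corner e. t (x * y) = t (y * x)) \<and>
     (\<forall>p. minimal_projection_in e p \<longrightarrow> t p = 1)"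

(* Extensionality only fixes the irrelevant values outside corner e, so that THE is unique. *)
definition Tr :: "'a::cstar_algebra \<Rightarrow> 'a \<Rightarrow> complex" where
  "Tr e = (THE t. is_trace_on e t \<and> t \<in> extensional (corner e))"

(* Functional calculus for self-adjoint elements of corner e:
   if a = (\<Sum>l\<in>L. l p_l) with mutually orthogonal projections p_l of sum e (p_l = 0 allowed),
   then f(a) = (\<Sum>l\<in>L. f(l) p_l). *)
definition functional_calculus ::
    "'a::cstar_algebra \<Rightarrow> (real \<Rightarrow> real) \<Rightarrow> 'a \<Rightarrow> 'a" where
  "functional_calculus e f a = (THE b. \<exists>L p. finite L \<and>
     (\<forall>l\<in>L. p l \<in> corner e \<and> projection (p l)) \<and>
     (\<forall>l\<in>L. \<forall>m\<in>L. l \<noteq> m \<longrightarrow> p l * p m = 0) \<and>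
     (\<Sum>l\<in>L. p l) = e \<and>
     a = (\<Sum>l\<in>L. l *\<^sub>R p l) \<and>
     b = (\<Sum>l\<in>L. f l *\<^sub>R p l))"

definition eta :: "real \<Rightarrow> real" where
  "eta t = (if t > 0 then - t * ln t else 0)"

(* Re is only a coercion: the trace of a self-adjoint element is real. *)
definition entropy :: "'a::cstar_algebra \<Rightarrow> 'a \<Rightarrow> real" where
  "entropy e a = Re (Tr e (functional_calculus e eta a))"

definition states :: "'a::cstar_algebra \<Rightarrow> 'a set" where
  "states e = {a. positive_in e a \<and> Tr e a = 1}"

(* Capacity of a map from corner e to corner f. Suprema are taken in the extended reals, so a
   map defined on the zero algebra (where states e = {}) has capacity - \<infinity>. *)
definition capacity_at ::
    "'a::cstar_algebra \<Rightarrow> 'b::cstar_algebra \<Rightarrow> ('a \<Rightarrow> 'b) \<Rightarrow> 'a \<Rightarrow> ereal" where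
  "capacity_at e f \<Phi> a =
     Sup {ereal (entropy f (\<Phi> a) - (\<Sum>i<k. l i * entropy f (\<Phi> (x i)))) | (k::nat) l x.
            (\<forall>i<k. 0 \<le> l i \<and> x i \<in> states e) \<and> (\<Sum>i<k. l i) = 1 \<and>
            (\<Sum>i<k. l i *\<^sub>R x i) = a}"

definition capacity ::
    "'a::cstar_algebra \<Rightarrow> 'b::cstar_algebra \<Rightarrow> ('a \<Rightarrow> 'b) \<Rightarrow> ereal" where
  "capacity e f \<Phi> = (SUP a\<in>states e. capacity_at e f \<Phi> a)"

(* Continuous extensions with exp (- \<infinity>) = 0 and log 0 = - \<infinity>. *)
fun exp_ereal :: "ereal \<Rightarrow> ereal" where
  "exp_ereal (ereal r) = ereal (exp r)"
| "exp_ereal PInfty = \<infinity>"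
| "exp_ereal MInfty = 0"

fun log_ereal :: "ereal \<Rightarrow> ereal" where
  "log_ereal (ereal r) = (if r > 0 then ereal (ln r) else -\<infinity>)"
| "log_ereal PInfty = \<infinity>"
| "log_ereal MInfty = -\<infinity>"

end

theory Submission
  imports Defs "HOL-Computational_Algebra.Fundamental_Theorem_Algebra"
begin

text \<open>
  Let \<open>f\<^sub>i = \<Phi>(e\<^sub>i)\<close>. Positivity forces \<open>\<Phi>(e\<^sub>i x e\<^sub>i) = f\<^sub>i \<Phi>(x) f\<^sub>i\<close>. For the upper bound let \<open>a = \<Sum>\<lambda>\<^sub>k x\<^sub>k\<close> be an
  ensemble. Pinching gives \<open>S(\<Phi>(a)) \<le> \<Sum> S(f\<^sub>i \<Phi>(a) f\<^sub>i)\<close>. In the other direction, writing \<open>b = y\<^sup>* y\<close>,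
  the compression \<open>f\<^sub>i b f\<^sub>i\<close> is isospectral to \<open>y f\<^sub>i y\<^sup>*\<close>, these add up to \<open>y y\<^sup>*\<close>, and concavity of \<open>S\<close>
  shows that \<open>S(b)\<close> is at least the average of the entropies of the normalized \<open>f\<^sub>i b f\<^sub>i\<close>. Applied to
  \<open>b = \<Phi>(x\<^sub>k)\<close> this bounds the value of the ensemble by \<open>\<Sum> \<eta>(p\<^sub>i) + p\<^sub>i C(\<Phi>\<^sub>i)\<close> with \<open>p\<^sub>i = Tr(e\<^sub>i a)\<close>, and the
  maximum of this expression over probability vectors is \<open>log \<Sum> exp C(\<Phi>\<^sub>i)\<close>. For the lower bound, mix
  nearly optimal ensembles of the \<open>\<Phi>\<^sub>i\<close> with the maximizing weights \<open>p\<^sub>i\<close>.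

  Underneath, the spectral theorem, the trace and its positivity are derived purely algebraically:
  the norm enters only through \<open>x\<^sup>* x = 0 \<Longrightarrow> x = 0\<close>.
\<close>

text \<open>Complete positivity is not assumed, so no dilation relates \<open>\<Phi>\<close> to its
  blocks. What replaces it: a real quadratic that is nonnegative and has no constant term has no
  linear term either, which removes the off-diagonal blocks. The subtracted terms of an ensemble are
  the obstacle in the upper bound, because they need an estimate from below while pinching only
  bounds from above. The pieces \<open>f i * b * f i\<close> add up to the pinched operator, not to
  \<open>b\<close>; the pieces \<open>y * f i * star y\<close> add up to something isospectral to
  \<open>b\<close>, and only then does concavity apply. Entropies are mostly used in the homogeneous
  form \<open>entropy 1 a - eta (tr a)\<close>. Weights are then absorbed into the members of an
  ensemble, and the correction \<open>eta (tr a)\<close> is the source of the terms in the p_i.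
  Pinching and concavity are two instances of one Gibbs inequality, which, like the optimization
  over weights, rests on the tangent of \<open>eta\<close>. A zero projection among the
  \<open>e i\<close> gives the zero algebra, of capacity \<open>- \<infinity>\<close>; the finite
  computations run over the nonzero ones.\<close>

lemma scaleC_one [simp]: "1 *\<^sub>C x = (x::'a::cstar_algebra)"
  using scaleR_scaleC[of 1 x] by simp

interpretation cvs: vector_space "scaleC :: complex \<Rightarrow> 'a::cstar_algebra \<Rightarrow> 'a"
  by unfold_locales (simp_all add: scaleC_add_right scaleC_add_left scaleC_scaleC)

declare mult_scaleC_left [simp] mult_scaleC_right [simp] star_star [simp] scaleC_scaleC [simp]

lemma star_zero [simp]: "star (0::'a::cstar_algebra) = 0"
  using star_add[of 0 "0::'a"] by simp

lemma star_minus [simp]: "star (- x) = - star (x::'a::cstar_algebra)"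
  using star_add[of x "-x"] by (simp add: eq_neg_iff_add_eq_0 add.commute)

lemma star_diff: "star (x - y) = star x - star (y::'a::cstar_algebra)"
  using star_add[of x "-y"] by simp

lemma star_sum: "star (\<Sum>i\<in>A. f i) = (\<Sum>i\<in>A. star (f i :: 'a::cstar_algebra))"
  by (induction A rule: infinite_finite_induct) (simp_all add: star_add)

lemma star_one [simp]: "star (1::'a::cstar_algebra) = 1"
  using star_mult[of "star 1" "1::'a"] by simp

lemma star_scaleR: "star (r *\<^sub>R x) = r *\<^sub>R star (x::'a::cstar_algebra)"
  by (simp add: scaleR_scaleC star_scaleC)

lemma star_mult_self_eq_0 [simp]: "star x * x = 0 \<longleftrightarrow> (x::'a::cstar_algebra) = 0"
  using norm_star_mult_self[of x] by auto

section \<open>Projections and corners\<close>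

lemma projection_star: "projection p \<Longrightarrow> star p = p"
  by (simp add: projection_def)

lemma projection_idem: "projection p \<Longrightarrow> p * p = p"
  by (simp add: projection_def)

lemma projection_idem_left: "projection p \<Longrightarrow> p * (p * x) = p * x"
  by (simp add: projection_def flip: mult.assoc)

lemma projection_zero [simp]: "projection 0"
  by (simp add: projection_def)

lemma projection_one [simp]: "projection 1"
  by (simp add: projection_def)

lemma projection_diff:
  assumes "projection e" "projection q" "e * q = q"
  shows "projection (e - q)"
proof -
  have "q * e = q" using assms by (metis projection_def star_mult)
  then show ?thesis using assms by (simp add: projection_def star_diff algebra_simps)
qed

lemma corner_iff:
  assumes "projection e"
  shows "x \<in> corner e \<longleftrightarrow> e * x = x \<and> x * e = x"
proof
  assume "x \<in> corner e"
  then obtain y where "x = e * y * e" by (auto simp: corner_def)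
  then show "e * x = x \<and> x * e = x"
    using projection_idem[OF assms] by (metis mult.assoc)
next
  assume "e * x = x \<and> x * e = x"
  then have "x = e * x * e" by simp
  then show "x \<in> corner e" by (auto simp: corner_def)
qed

subsection \<open>The spectral theorem\<close>

text \<open>Horner evaluation of a complex polynomial at an element of the algebra: the coefficients
  act through \<open>scaleC\<close>, so coefficients and argument have different types.\<close>

definition poly_at :: "complex poly \<Rightarrow> 'a::cstar_algebra \<Rightarrow> 'a" where
  "poly_at q a = fold_coeffs (\<lambda>c s. c *\<^sub>C 1 + a * s) q 0"

lemma poly_at_0 [simp]: "poly_at 0 a = 0"
  by (simp add: poly_at_def)

lemma poly_at_pCons [simp]: "poly_at (pCons c q) a = c *\<^sub>C 1 + a * poly_at q a"
  by (cases "q = 0 \<and> c = 0") (auto simp: poly_at_def)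

lemma poly_at_add [simp]: "poly_at (p + q) a = poly_at p a + poly_at q a"
  by (induction p q rule: poly_induct2) (simp_all add: algebra_simps)

lemma poly_at_smult [simp]: "poly_at (smult c p) a = c *\<^sub>C poly_at p a"
  by (induction p) (simp_all add: algebra_simps)

lemma poly_at_minus [simp]: "poly_at (- p) a = - poly_at p a"
  using poly_at_smult[of "-1" p a] by simp

lemma poly_at_diff [simp]: "poly_at (p - q) a = poly_at p a - poly_at q a"
  using poly_at_add[of p "-q" a] by simp

lemma poly_at_sum [simp]: "poly_at (\<Sum>i\<in>A. f i) a = (\<Sum>i\<in>A. poly_at (f i) a)"
  by (induction A rule: infinite_finite_induct) simp_all

lemma poly_at_mult [simp]: "poly_at (p * q) a = poly_at p a * poly_at q a"
  by (induction p) (simp_all add: algebra_simps)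

lemma poly_at_one [simp]: "poly_at 1 a = 1"
  by (simp add: one_pCons)

lemma poly_at_power [simp]: "poly_at (p ^ n) a = poly_at p a ^ n"
  by (induction n) simp_all

lemma poly_at_monom: "poly_at (monom c n) a = c *\<^sub>C a ^ n"
  by (induction n) (simp_all add: monom_0 monom_Suc)

lemma poly_at_commute: "x * a = a * x \<Longrightarrow> x * poly_at p a = poly_at p a * x"
proof (induction p)
  case (pCons c p)
  then have "x * (a * poly_at p a) = a * (poly_at p a * x)"
    by (metis mult.assoc)
  then show ?case by (simp add: algebra_simps)
qed simp

lemma star_poly_at:
  assumes "star a = a"
  shows "star (poly_at p a) = poly_at (map_poly cnj p) a"
proof (induction p)
  case (pCons c p)
  have "star (a * poly_at p a) = a * poly_at (map_poly cnj p) a"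
    using pCons.IH assms by (simp add: star_mult poly_at_commute)
  then show ?case
    by (simp add: star_add star_scaleC map_poly_pCons pCons.hyps)
qed simp

text \<open>For self-adjoint \<open>h\<close>, \<open>h * h = star h * h\<close>, so a vanishing
  power with exponent \<open>2 ^ k\<close> can be halved down to \<open>h\<close> itself. A normal
  \<open>b\<close> reduces to \<open>h = star b * b\<close>, whose powers are
  \<open>star b ^ m * b ^ m\<close>.\<close>

lemma normal_nilpotent_eq_0:
  fixes b :: "'a::cstar_algebra"
  assumes "star b * b = b * star b" "b ^ n = 0"
  shows "b = 0"
proof -
  have sq: "h = 0" if "star h = h" "h ^ (2 ^ k) = 0" for h :: 'a and k
    using that
  proof (induction k arbitrary: h)
    case (Suc k)
    have "star (h * h) = h * h" "(h * h) ^ (2 ^ k) = 0"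
      using Suc.prems by (simp_all add: star_mult power_mult power2_eq_square)
    from Suc.IH[OF this] show "h = 0"
      using Suc.prems(1) star_mult_self_eq_0[of h] by simp
  qed simp
  have "(star b * b) ^ m = star b ^ m * b ^ m" for m
  proof (induction m)
    case (Suc m)
    have "b * star b ^ m = star b ^ m * b"
      using assms(1) by (metis power_commuting_commutes)
    then show ?case using Suc.IH by (simp add: mult.assoc) (metis mult.assoc)
  qed simp
  then have "(star b * b) ^ n = 0" using assms(2) by simp
  then have "(star b * b) ^ (2 ^ n) = 0"
    using power_add[of "star b * b" n "2 ^ n - n"] less_exp[of n] by simp
  then have "star b * b = 0" using sq[of "star b * b" n] by (simp add: star_mult)
  then show ?thesis by simp
qed

lemma exists_annihilating_poly:
  fixes a :: "'a::fd_cstar_algebra"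
  obtains q where "q \<noteq> 0" "poly_at q a = 0"
proof -
  obtain B :: "'a set" where B: "finite B" "\<And>x. \<exists>c. x = (\<Sum>b\<in>B. c b *\<^sub>C b)"
    using finite_dimensional by blast
  have span: "cvs.span B = UNIV"
    using B(2) by (auto simp: cvs.span_finite[OF B(1)])
  let ?n = "card B"
  show thesis
  \<comment> \<open>Dependence concerns the set of powers, in which equal powers are identified.
    Coinciding powers are therefore treated apart, with \<open>a ^ i - a ^ j = 0\<close> as the
    relation.\<close>
  proof (cases "inj_on (\<lambda>i. a ^ i) {..?n}")
    case True
    let ?S = "(\<lambda>i. a ^ i) ` {..?n}"
    have "card ?S > card B" using card_image[OF True] by simp
    then have "cvs.dependent ?S"
      using cvs.independent_span_bound[OF B(1), of ?S] span by force
    then obtain u where u: "(\<Sum>v\<in>?S. u v *\<^sub>C v) = 0" "\<exists>v\<in>?S. u v \<noteq> 0"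
      by (auto simp: cvs.dependent_finite)
    define q where "q = (\<Sum>i\<le>?n. monom (u (a ^ i)) i)"
    have "poly_at q a = 0"
      using u(1) by (simp add: q_def poly_at_monom sum.reindex[OF True])
    moreover obtain j where j: "j \<le> ?n" "u (a ^ j) \<noteq> 0" using u(2) by auto
    have "coeff q j = u (a ^ j)"
      using j(1) by (simp add: q_def coeff_sum coeff_monom)
    then have "q \<noteq> 0" using j(2) by auto
    ultimately show thesis using that by blast
  next
    case False
    then obtain i j where ij: "i \<noteq> j" "a ^ i = a ^ j" by (auto simp: inj_on_def)
    have "coeff (monom 1 i - monom (1::complex) j) i = 1" using ij by simp
    then have "monom 1 i - monom (1::complex) j \<noteq> 0" by (metis coeff_0 zero_neq_one)
    moreover have "poly_at (monom 1 i - monom 1 j) a = 0"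
      using ij(2) by (simp add: poly_at_monom)
    ultimately show thesis using that by blast
  qed
qed

text \<open>\<open>R\<close> is the root set of an annihilating \<open>q\<close>. If
  \<open>g\<close> vanishes on \<open>R\<close>, then \<open>q\<close> divides a power of
  \<open>g\<close>, so \<open>poly_at g a\<close> is nilpotent and normal, hence zero. As
  \<open>q\<close> need not be minimal, \<open>R\<close> may exceed the spectrum.\<close>

lemma poly_at_eq_0_spectrum:
  fixes a :: "'a::fd_cstar_algebra"
  assumes "star a = a"
  obtains R where "finite R" "\<And>g. (\<And>r. r \<in> R \<Longrightarrow> poly g r = 0) \<Longrightarrow> poly_at g a = 0"
proof -
  obtain q where q: "q \<noteq> 0" "poly_at q a = 0" using exists_annihilating_poly .
  show thesis
  proof (rule that)
    show "finite {r. poly q r = 0}" using q(1) by (rule poly_roots_finite)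
    fix g assume "\<And>r. r \<in> {r. poly q r = 0} \<Longrightarrow> poly g r = 0"
    then have "q dvd g ^ degree q" using nullstellensatz_univariate[of q g] q(1) by auto
    then have "poly_at g a ^ degree q = 0"
      using q(2) by (metis dvdE mult_zero_left poly_at_mult poly_at_power)
    moreover have "star (poly_at g a) * poly_at g a = poly_at g a * star (poly_at g a)"
      by (simp add: star_poly_at[OF assms] mult.commute flip: poly_at_mult)
    ultimately show "poly_at g a = 0" using normal_nilpotent_eq_0 by blast
  qed
qed

text \<open>For \<open>d = p - star p * p\<close>, normality and idempotence give
  \<open>star d * d = 0\<close>, so \<open>p = star p * p\<close> is self-adjoint.\<close>

lemma projection_if_normal_idem:
  fixes p :: "'a::cstar_algebra"
  assumes "star p * p = p * star p" "p * p = p"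
  shows "projection p"
proof -
  have "star p * star p = star p" using assms(2) by (metis star_mult)
  then have "star (p - star p * p) * (p - star p * p) = 0"
    using assms by (simp add: star_diff star_mult left_diff_distrib right_diff_distrib)
      (metis (no_types, lifting) mult.assoc)
  then have "p = star p * p" by (simp only: star_mult_self_eq_0) simp
  then have "star p = p" by (metis star_mult star_star)
  then show ?thesis using assms by (simp add: projection_def)
qed

section \<open>Orthogonal families of projections and spectral decompositions\<close>

definition orthogonal_projections :: "'i set \<Rightarrow> ('i \<Rightarrow> 'a::cstar_algebra) \<Rightarrow> bool" where
  "orthogonal_projections I p \<longleftrightarrow> finite I \<and> (\<forall>i\<in>I. projection (p i)) \<and>
     (\<forall>i\<in>I. \<forall>j\<in>I. i \<noteq> j \<longrightarrow> p i * p j = 0)"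

lemma orthogonal_projections_mult:
  assumes "orthogonal_projections I p" "i \<in> I" "j \<in> I"
  shows "p i * p j = (if i = j then p i else 0)"
  using assms by (auto simp: orthogonal_projections_def projection_def)

lemma sum_mult_orthogonal_projections:
  assumes "orthogonal_projections I p" "j \<in> I"
  shows "(\<Sum>i\<in>I. v i *\<^sub>R p i) * p j = v j *\<^sub>R p j"
    and "p j * (\<Sum>i\<in>I. v i *\<^sub>R p i) = v j *\<^sub>R p j"
proof -
  have fin: "finite I" using assms by (simp add: orthogonal_projections_def)
  have "(\<Sum>i\<in>I. v i *\<^sub>R p i) * p j = (\<Sum>i\<in>I. if i = j then v i *\<^sub>R p i else 0)"
    unfolding sum_distrib_right
    by (rule sum.cong) (use orthogonal_projections_mult[OF assms(1) _ assms(2)] in auto)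
  then show "(\<Sum>i\<in>I. v i *\<^sub>R p i) * p j = v j *\<^sub>R p j" using fin assms(2) by simp
  have "p j * (\<Sum>i\<in>I. v i *\<^sub>R p i) = (\<Sum>i\<in>I. if i = j then v i *\<^sub>R p i else 0)"
    unfolding sum_distrib_left
    by (rule sum.cong) (use orthogonal_projections_mult[OF assms(1) assms(2)] in auto)
  then show "p j * (\<Sum>i\<in>I. v i *\<^sub>R p i) = v j *\<^sub>R p j" using fin assms(2) by simp
qed

lemma sum_mult_sum_orthogonal_projections:
  assumes "orthogonal_projections I p"
  shows "(\<Sum>i\<in>I. v i *\<^sub>R p i) * (\<Sum>i\<in>I. w i *\<^sub>R p i) = (\<Sum>i\<in>I. (v i * w i) *\<^sub>R p i)"
  unfolding sum_distrib_left
  by (rule sum.cong) (simp_all add: sum_mult_orthogonal_projections[OF assms] mult.commute)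

lemma star_sum_projections:
  assumes "orthogonal_projections I p"
  shows "star (\<Sum>i\<in>I. v i *\<^sub>R p i) = (\<Sum>i\<in>I. v i *\<^sub>R p i)"
  unfolding star_sum
  by (rule sum.cong) (use assms in \<open>auto simp: star_scaleR projection_def orthogonal_projections_def\<close>)

lemma projection_sum:
  assumes "orthogonal_projections I p"
  shows "projection (\<Sum>i\<in>I. p i)"
  using sum_mult_sum_orthogonal_projections[OF assms, of "\<lambda>_. 1" "\<lambda>_. 1"]
    star_sum_projections[OF assms, of "\<lambda>_. 1"]
  by (simp add: projection_def)

lemma corner_0 [simp]: "0 \<in> corner e"
  by (auto simp: corner_def intro: exI[of _ 0])

lemma corner_add: "x \<in> corner e \<Longrightarrow> y \<in> corner e \<Longrightarrow> x + y \<in> corner e"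
  by (auto simp: corner_def) (metis distrib_left distrib_right)

lemma corner_scaleC: "x \<in> corner e \<Longrightarrow> c *\<^sub>C x \<in> corner e"
  by (auto simp: corner_def) (metis mult_scaleC_left mult_scaleC_right)

lemma corner_scaleR: "x \<in> corner e \<Longrightarrow> c *\<^sub>R x \<in> corner e"
  by (simp add: scaleR_scaleC corner_scaleC)

lemma corner_sum: "(\<And>i. i \<in> I \<Longrightarrow> f i \<in> corner e) \<Longrightarrow> (\<Sum>i\<in>I. f i) \<in> corner e"
  by (induction I rule: infinite_finite_induct) (auto intro: corner_add)

lemma projection_in_corner: "projection e \<Longrightarrow> e \<in> corner e"
  by (simp add: corner_iff projection_idem)

lemma corner_compress: "e * x * e \<in> corner e"
  by (auto simp: corner_def)

text \<open>The projections are the Lagrange polynomials of the root set \<open>R\<close> evaluated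
  at \<open>a\<close>. As polynomials in \<open>a\<close> they commute with whatever commutes with
  \<open>a\<close>, which later permits cutting them by the unit of a corner.\<close>

lemma spectral_theorem_commuting:
  fixes a :: "'a::fd_cstar_algebra"
  assumes "star a = a"
  obtains L p where "orthogonal_projections L p" "(\<Sum>l\<in>L. p l) = 1" "a = (\<Sum>l\<in>L. l *\<^sub>R p l)"
    "\<And>l x. x * a = a * x \<Longrightarrow> x * p l = p l * x"
proof -
  obtain R where R: "finite R" "\<And>g. (\<And>r. r \<in> R \<Longrightarrow> poly g r = 0) \<Longrightarrow> poly_at g a = 0"
    using poly_at_eq_0_spectrum[OF assms] by metis
  have eq: "poly_at f a = poly_at g a" if "\<And>r. r \<in> R \<Longrightarrow> poly f r = poly g r" for f g
    using R(2)[of "f - g"] that by simp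
  define lag where "lag r = smult (inverse (\<Prod>s\<in>R-{r}. r - s)) (\<Prod>s\<in>R-{r}. [:-s, 1:])" for r
  have lag: "poly (lag r) s = (if s = r then 1 else 0)" if "r \<in> R" "s \<in> R" for r s
  proof (cases "s = r")
    case True
    have "(\<Prod>s\<in>R-{r}. r - s) \<noteq> 0" using R(1) by simp
    then show ?thesis using True by (simp add: lag_def poly_prod)
  next
    case False
    then have "(\<Prod>t\<in>R-{r}. s - t) = 0" using R(1) that by auto
    then show ?thesis using False by (simp add: lag_def poly_prod)
  qed
  define P where "P r = poly_at (lag r) a" for r
  have PP: "P r * P s = (if r = s then P r else 0)" if "r \<in> R" "s \<in> R" for r s
  proof -
    have "poly_at (lag r * lag s) a = poly_at (if r = s then lag r else 0) a"
      by (rule eq) (use that lag in auto)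
    then show ?thesis by (simp add: P_def split: if_splits)
  qed
  have Psum: "(\<Sum>r\<in>R. P r) = 1"
  proof -
    have "poly_at (\<Sum>r\<in>R. lag r) a = poly_at 1 a"
      by (rule eq) (use lag R(1) in \<open>simp add: poly_sum mult_delta_right\<close>)
    then show ?thesis by (simp add: P_def)
  qed
  have Pa: "a = (\<Sum>r\<in>R. r *\<^sub>C P r)"
  proof -
    have "poly_at [:0, 1:] a = poly_at (\<Sum>r\<in>R. smult r (lag r)) a"
      by (rule eq) (use lag R(1) in \<open>simp add: poly_sum mult_delta_right\<close>)
    then show ?thesis by (simp add: P_def)
  qed
  have Pcomm: "x * P r = P r * x" if "x * a = a * x" for x r
    unfolding P_def using that by (rule poly_at_commute)
  have Pproj: "projection (P r)" if "r \<in> R" for r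
  proof (rule projection_if_normal_idem)
    show "star (P r) * P r = P r * star (P r)"
      unfolding P_def by (simp add: star_poly_at[OF assms] mult.commute flip: poly_at_mult)
  qed (use PP that in simp)
  \<comment> \<open>\<open>a * P r\<close>, which is \<open>r\<close> times \<open>P r\<close>, is
    self-adjoint because the factors commute; so \<open>r\<close> is its own conjugate unless
    \<open>P r = 0\<close>. This allows passing to the real index set \<open>L\<close>.\<close>
  have Preal: "P r = 0" if "r \<in> R" "r \<notin> \<real>" for r
  proof -
    have aP: "a * P r = r *\<^sub>C P r"
    proof -
      have "a * P r = (\<Sum>s\<in>R. s *\<^sub>C (P s * P r))"
        by (subst Pa) (simp add: sum_distrib_right)
      also have "\<dots> = (\<Sum>s\<in>R. if s = r then r *\<^sub>C P r else 0)"
        by (rule sum.cong) (use PP that in auto)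
      finally show ?thesis using that(1) R(1) by simp
    qed
    have "star (a * P r) = a * P r"
      using Pproj[OF that(1)] Pcomm[of a r] assms by (simp add: star_mult projection_star)
    then have "cnj r *\<^sub>C P r = r *\<^sub>C P r"
      using Pproj[OF that(1)] by (simp add: aP star_scaleC projection_star)
    then show ?thesis using that(2) Reals_cnj_iff by auto
  qed
  define L where "L = {l. complex_of_real l \<in> R}"
  have finL: "finite L"
    unfolding L_def using R(1) finite_vimageI[of R complex_of_real]
    by (simp add: inj_of_real vimage_def)
  have sumL: "(\<Sum>r\<in>R. g r) = (\<Sum>l\<in>L. g (complex_of_real l))"
    if "\<And>r. r \<in> R \<Longrightarrow> r \<notin> \<real> \<Longrightarrow> g r = 0" for g :: "complex \<Rightarrow> 'a"
  proof -
    have "(\<Sum>l\<in>L. g (complex_of_real l)) = (\<Sum>r\<in>complex_of_real ` L. g r)"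
      by (simp add: sum.reindex inj_on_def)
    also have "\<dots> = (\<Sum>r\<in>R. g r)"
      by (rule sum.mono_neutral_left) (use R(1) that in \<open>auto simp: L_def Reals_def\<close>)
    finally show ?thesis by simp
  qed
  show thesis
  proof (rule that)
    show "orthogonal_projections L (\<lambda>l. P (complex_of_real l))"
      using finL Pproj PP by (auto simp: orthogonal_projections_def L_def)
    show "(\<Sum>l\<in>L. P (complex_of_real l)) = 1" using Psum sumL[of P] Preal by simp
    show "a = (\<Sum>l\<in>L. l *\<^sub>R P (complex_of_real l))"
      using Pa sumL[of "\<lambda>r. r *\<^sub>C P r"] Preal by (simp add: scaleR_scaleC)
  qed (use Pcomm in blast)
qed

lemma spectral_theorem:
  fixes a :: "'a::fd_cstar_algebra"
  assumes "star a = a" "projection e" "a \<in> corner e"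
  obtains L p where "orthogonal_projections L p" "\<And>l. l \<in> L \<Longrightarrow> p l \<in> corner e"
    "\<And>l. l \<in> L \<Longrightarrow> p l \<noteq> 0" "(\<Sum>l\<in>L. p l) = e" "a = (\<Sum>l\<in>L. l *\<^sub>R p l)"
proof -
  obtain K q where K: "orthogonal_projections K q" "(\<Sum>l\<in>K. q l) = 1" "a = (\<Sum>l\<in>K. l *\<^sub>R q l)"
    "\<And>l x. x * a = a * x \<Longrightarrow> x * q l = q l * x"
    using spectral_theorem_commuting[OF assms(1)] by blast
  have ea: "e * a = a" "a * e = a" using assms by (simp_all add: corner_iff)
  have comm: "e * q l = q l * e" for l using K(4) ea by simp
  have ee: "e * e = e" using assms(2) by (rule projection_idem)
  define L where "L = {l\<in>K. q l * e \<noteq> 0}"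
  define p where "p l = q l * e" for l
  have fin: "finite K" using K(1) by (simp add: orthogonal_projections_def)
  have pp: "p l * p m = q l * q m * e" for l m
    unfolding p_def by (metis comm ee mult.assoc)
  show thesis
  proof (rule that)
    have "star (p l) = p l" if "l \<in> K" for l
      using K(1) that comm assms(2)
      by (simp add: p_def star_mult projection_star orthogonal_projections_def)
    then show "orthogonal_projections L p"
      using orthogonal_projections_mult[OF K(1)] fin
      by (auto simp: orthogonal_projections_def projection_def pp L_def) (auto simp: p_def)
    show "p l \<in> corner e" for l
      by (simp add: corner_iff[OF assms(2)] p_def mult.assoc ee) (simp add: comm ee flip: mult.assoc, simp add: mult.assoc ee)
    show "l \<in> L \<Longrightarrow> p l \<noteq> 0" for l by (simp add: L_def p_def)
    have "(\<Sum>l\<in>L. p l) = (\<Sum>l\<in>K. q l * e)"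
      unfolding L_def p_def by (rule sum.mono_neutral_left) (use fin in auto)
    then show "(\<Sum>l\<in>L. p l) = e" using K(2) by (simp flip: sum_distrib_right)
    have "(\<Sum>l\<in>L. l *\<^sub>R p l) = (\<Sum>l\<in>K. l *\<^sub>R (q l * e))"
      unfolding L_def p_def by (rule sum.mono_neutral_left) (use fin in auto)
    also have "\<dots> = a * e" by (subst K(3)) (simp add: sum_distrib_right)
    finally show "a = (\<Sum>l\<in>L. l *\<^sub>R p l)" using ea by simp
  qed
qed

text \<open>Multiplying the common element by \<open>p i\<close> on the left and \<open>q j\<close>
  on the right gives \<open>v i = w j\<close> whenever \<open>p i * q j \<noteq> 0\<close>. Repeated
  values and zero projections are allowed.\<close>

lemma calculus_unique:
  assumes I: "orthogonal_projections I p" "(\<Sum>i\<in>I. p i) = e"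
    and J: "orthogonal_projections J q" "(\<Sum>j\<in>J. q j) = e"
    and eq: "(\<Sum>i\<in>I. v i *\<^sub>R p i) = (\<Sum>j\<in>J. w j *\<^sub>R q j)"
  shows "(\<Sum>i\<in>I. g (v i) *\<^sub>R p i) = (\<Sum>j\<in>J. g (w j) *\<^sub>R q j)"
proof -
  have key: "g (v i) *\<^sub>R (p i * q j) = g (w j) *\<^sub>R (p i * q j)" if "i \<in> I" "j \<in> J" for i j
  proof -
    have "v i *\<^sub>R (p i * q j) = p i * (\<Sum>i\<in>I. v i *\<^sub>R p i) * q j"
      by (simp add: sum_mult_orthogonal_projections[OF I(1) that(1)])
    also have "\<dots> = w j *\<^sub>R (p i * q j)"
      by (simp add: eq mult.assoc sum_mult_orthogonal_projections[OF J(1) that(2)])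
    finally show ?thesis by (cases "p i * q j = 0") auto
  qed
  have pe: "p i * e = p i" if "i \<in> I" for i
    using sum_mult_orthogonal_projections(2)[OF I(1) that, of "\<lambda>_. 1"] I(2) by simp
  have qe: "e * q j = q j" if "j \<in> J" for j
    using sum_mult_orthogonal_projections(1)[OF J(1) that, of "\<lambda>_. 1"] J(2) by simp
  have "(\<Sum>i\<in>I. g (v i) *\<^sub>R p i) = (\<Sum>i\<in>I. g (v i) *\<^sub>R (p i * (\<Sum>j\<in>J. q j)))"
    by (rule sum.cong) (use pe J(2) in auto)
  also have "\<dots> = (\<Sum>i\<in>I. \<Sum>j\<in>J. g (v i) *\<^sub>R (p i * q j))"
    by (simp add: sum_distrib_left scaleR_sum_right)
  also have "\<dots> = (\<Sum>i\<in>I. \<Sum>j\<in>J. g (w j) *\<^sub>R (p i * q j))"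
    using key by (intro sum.cong) auto
  also have "\<dots> = (\<Sum>j\<in>J. g (w j) *\<^sub>R ((\<Sum>i\<in>I. p i) * q j))"
    by (subst sum.swap) (simp add: sum_distrib_right scaleR_sum_right)
  also have "\<dots> = (\<Sum>j\<in>J. g (w j) *\<^sub>R q j)"
    by (rule sum.cong) (use qe I(2) in auto)
  finally show ?thesis .
qed

lemma functional_calculus_sum:
  fixes p :: "'i \<Rightarrow> 'a::fd_cstar_algebra"
  assumes e: "projection e" and I: "orthogonal_projections I p" "\<And>i. i \<in> I \<Longrightarrow> p i \<in> corner e"
    and g: "g 0 = 0"
  shows "functional_calculus e g (\<Sum>i\<in>I. v i *\<^sub>R p i) = (\<Sum>i\<in>I. g (v i) *\<^sub>R p i)"
proof -
  let ?a = "\<Sum>i\<in>I. v i *\<^sub>R p i"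
  have fin: "finite I" using I(1) by (simp add: orthogonal_projections_def)
  \<comment> \<open>The projections may fail to sum to \<open>e\<close>; the index
    \<open>None\<close> carries the missing projection with eigenvalue 0, harmless because
    \<open>g 0 = 0\<close>.\<close>
  define J where "J = insert None (Some ` I)"
  define q where "q j = (case j of None \<Rightarrow> e - (\<Sum>i\<in>I. p i) | Some i \<Rightarrow> p i)" for j
  define w where "w j = (case j of None \<Rightarrow> 0 | Some i \<Rightarrow> v i)" for j
  have sumJ: "(\<Sum>j\<in>J. f j) = f None + (\<Sum>i\<in>I. f (Some i))" for f :: "'i option \<Rightarrow> 'a"
    unfolding J_def using fin by (subst sum.insert) (auto simp: sum.reindex)
  have pe: "e * p i = p i" "p i * e = p i" if "i \<in> I" for i
    using I(2)[OF that] corner_iff[OF e] by auto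
  have "e * (\<Sum>i\<in>I. p i) = (\<Sum>i\<in>I. p i)" using pe by (simp add: sum_distrib_left)
  then have "projection (q None)"
    unfolding q_def using projection_diff[OF e projection_sum[OF I(1)]] by simp
  moreover have "p i * q None = 0" "q None * p i = 0" if "i \<in> I" for i
    using sum_mult_orthogonal_projections[OF I(1) that, of "\<lambda>_. 1"] pe[OF that]
    by (simp_all add: q_def algebra_simps)
  ultimately have J: "orthogonal_projections J q"
    using I(1) fin by (auto simp: orthogonal_projections_def J_def q_def)
  have Je: "(\<Sum>j\<in>J. q j) = e" by (simp add: sumJ) (simp add: q_def)
  have Ja: "(\<Sum>j\<in>J. w j *\<^sub>R q j) = ?a" by (simp add: sumJ) (simp add: q_def w_def)
  have Jg: "(\<Sum>j\<in>J. g (w j) *\<^sub>R q j) = (\<Sum>i\<in>I. g (v i) *\<^sub>R p i)"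
    by (simp add: sumJ) (simp add: q_def w_def g)
  have "?a \<in> corner e" by (intro corner_sum corner_scaleR I(2))
  then obtain L r where L: "orthogonal_projections L r" "\<And>l. l \<in> L \<Longrightarrow> r l \<in> corner e"
    "(\<Sum>l\<in>L. r l) = e" "?a = (\<Sum>l\<in>L. l *\<^sub>R r l)"
    using spectral_theorem[OF star_sum_projections[OF I(1)] e] by metis
  show ?thesis
    unfolding functional_calculus_def
  proof (rule the_equality)
    have "(\<Sum>i\<in>I. g (v i) *\<^sub>R p i) = (\<Sum>l\<in>L. g l *\<^sub>R r l)"
      using calculus_unique[OF J Je L(1,3), of w "\<lambda>l. l" g] Ja Jg L(4) by simp
    then show "\<exists>L r. finite L \<and> (\<forall>l\<in>L. r l \<in> corner e \<and> projection (r l)) \<and>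
        (\<forall>l\<in>L. \<forall>m\<in>L. l \<noteq> m \<longrightarrow> r l * r m = 0) \<and> (\<Sum>l\<in>L. r l) = e \<and>
        ?a = (\<Sum>l\<in>L. l *\<^sub>R r l) \<and> (\<Sum>i\<in>I. g (v i) *\<^sub>R p i) = (\<Sum>l\<in>L. g l *\<^sub>R r l)"
      using L unfolding orthogonal_projections_def by blast
    fix b
    assume "\<exists>L p. finite L \<and> (\<forall>l\<in>L. p l \<in> corner e \<and> projection (p l)) \<and>
        (\<forall>l\<in>L. \<forall>m\<in>L. l \<noteq> m \<longrightarrow> p l * p m = 0) \<and> (\<Sum>l\<in>L. p l) = e \<and>
        ?a = (\<Sum>l\<in>L. l *\<^sub>R p l) \<and> b = (\<Sum>l\<in>L. g l *\<^sub>R p l)"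
    then obtain K s where K: "orthogonal_projections K s" "(\<Sum>l\<in>K. s l) = e"
      "?a = (\<Sum>l\<in>K. l *\<^sub>R s l)" "b = (\<Sum>l\<in>K. g l *\<^sub>R s l)"
      unfolding orthogonal_projections_def by blast
    show "b = (\<Sum>i\<in>I. g (v i) *\<^sub>R p i)"
      using calculus_unique[OF J Je K(1,2), of w "\<lambda>l. l" g] Ja Jg K(3,4) by simp
  qed
qed

subsection \<open>The trace\<close>

text \<open>Multiplying a linear relation by one member isolates its coefficient, so orthogonal
  nonzero projections are linearly independent.\<close>

lemma card_orthogonal_projections_bounded:
  obtains N where "\<And>S::'a::fd_cstar_algebra set.
    orthogonal_projections S (\<lambda>p. p) \<Longrightarrow> 0 \<notin> S \<Longrightarrow> card S \<le> N"
proof -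
  obtain B :: "'a set" where B: "finite B" "\<And>x. \<exists>c. x = (\<Sum>b\<in>B. c b *\<^sub>C b)"
    using finite_dimensional by blast
  have span: "cvs.span B = UNIV"
    using B(2) by (auto simp: cvs.span_finite[OF B(1)])
  show thesis
  proof (rule that)
    fix S :: "'a set"
    assume S: "orthogonal_projections S (\<lambda>p. p)" "0 \<notin> S"
    have fin: "finite S" using S(1) by (simp add: orthogonal_projections_def)
    have "u q = 0" if u: "(\<Sum>p\<in>S. u p *\<^sub>C p) = 0" and q: "q \<in> S" for u q
    proof -
      have "0 = (\<Sum>p\<in>S. u p *\<^sub>C (p * q))"
        using u by (metis (no_types, lifting) mult_scaleC_left mult_zero_left sum.cong sum_distrib_right)
      also have "\<dots> = (\<Sum>p\<in>S. if p = q then u p *\<^sub>C p else 0)"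
        by (rule sum.cong) (use orthogonal_projections_mult[OF S(1) _ q] in auto)
      finally show ?thesis using fin q S(2) by auto
    qed
    then have "cvs.independent S" using fin by (auto simp: cvs.dependent_finite)
    then show "card S \<le> card B"
      using cvs.independent_span_bound[OF B(1), of S] span by simp
  qed
qed

text \<open>An orthogonal family of nonzero projections of maximal size consists of minimal ones.\<close>

lemma minimal_projections_sum:
  fixes e :: "'a::fd_cstar_algebra"
  assumes "projection e"
  obtains S where "orthogonal_projections S (\<lambda>p. p)" "\<And>p. p \<in> S \<Longrightarrow> minimal_projection_in e p"
    "\<Sum>S = e"
proof -
  define good where "good S \<longleftrightarrow> orthogonal_projections S (\<lambda>p. p) \<and> 0 \<notin> S \<and> S \<subseteq> corner e \<and> \<Sum>S = e"
    for S :: "'a set"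
  obtain N where N: "\<And>S::'a set. orthogonal_projections S (\<lambda>p. p) \<Longrightarrow> 0 \<notin> S \<Longrightarrow> card S \<le> N"
    using card_orthogonal_projections_bounded by blast
  have "good (if e = 0 then {} else {e})"
    using assms by (simp add: good_def orthogonal_projections_def projection_in_corner)
  moreover have "\<forall>S. good S \<longrightarrow> card S < Suc N" using N by (simp add: good_def le_imp_less_Suc)
  ultimately obtain S where S: "good S" "\<And>T. good T \<Longrightarrow> card T \<le> card S"
    using ex_has_greatest_nat[of good _ card "Suc N"] by blast
  have Sor: "orthogonal_projections S (\<lambda>p. p)" and S0: "0 \<notin> S" and Se: "S \<subseteq> corner e"
    and Ssum: "\<Sum>S = e" and fin: "finite S"
    using S(1) by (simp_all add: good_def orthogonal_projections_def)
  have Sproj: "projection p" if "p \<in> S" for p using Sor that by (simp add: orthogonal_projections_def)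
  show thesis
  proof (rule that[OF Sor _ Ssum])
    fix p assume p: "p \<in> S"
    have False if q: "q \<in> corner e" "projection q" "q * p = q" "q \<noteq> 0" "q \<noteq> p" for q
    proof -
      have pq: "p * q = q" using q(2,3) Sproj[OF p] by (metis projection_star star_mult)
      have pp: "p * p = p" and qq: "q * q = q"
        using projection_idem Sproj[OF p] q(2) by auto
      have pr: "p * r = 0" "r * p = 0" if "r \<in> S - {p}" for r
        using orthogonal_projections_mult[OF Sor] p that by auto
      have qr: "q * r = 0" "r * q = 0" if "r \<in> S - {p}" for r
        using pr[OF that] q(3) pq by (metis mult.assoc mult_zero_right, metis mult.assoc mult_zero_left)
      have qdiff: "q * (p - q) = 0" "(p - q) * q = 0" "(p - q) * (p - q) = p - q"
        using pp qq pq q(3) by (simp_all add: algebra_simps)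
      \<comment> \<open>A proper nonzero subprojection \<open>q\<close> would split \<open>p\<close>
        into \<open>q\<close> and \<open>p - q\<close>, giving a larger family with the same
        sum.\<close>
      define T where "T = insert q (insert (p - q) (S - {p}))"
      have n1: "q \<notin> S - {p}" using qr qq q(4) by force
      have n2: "p - q \<notin> S - {p}"
      proof
        assume "p - q \<in> S - {p}"
        then have "(p - q) * (p - q) = 0" using qr pr by (simp add: left_diff_distrib)
        then show False using qdiff(3) q(5) by simp
      qed
      have n3: "q \<noteq> p - q" using qdiff(1) qq q(4) by metis
      have "card T = Suc (Suc (card (S - {p})))"
        unfolding T_def using n1 n2 n3 fin by (simp add: card_insert_if)
      then have "card T = Suc (card S)" using p fin by (metis card_Suc_Diff1)
      moreover have "good T"
        unfolding good_def
      proof (intro conjI)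
        have "projection (p - q)" by (rule projection_diff[OF Sproj[OF p] q(2) pq])
        moreover have "r * s = 0" if "r \<in> S - {p}" "s \<in> S - {p}" "r \<noteq> s" for r s
          using orthogonal_projections_mult[OF Sor] that by auto
        ultimately show "orthogonal_projections T (\<lambda>p. p)"
          unfolding orthogonal_projections_def T_def using fin Sproj q(2) qr pr qdiff
          by (auto simp: left_diff_distrib right_diff_distrib)
        show "0 \<notin> T" using S0 q(4,5) by (auto simp: T_def)
        have "p - q \<in> corner e"
          using corner_add[of p e "-q"] corner_scaleR[of q e "-1"] Se p q(1) by auto
        then show "T \<subseteq> corner e" using Se q(1) by (auto simp: T_def)
        have "\<Sum>T = q + ((p - q) + \<Sum>(S - {p}))"
          unfolding T_def using n1 n2 n3 fin by simp
        also have "\<dots> = p + \<Sum>(S - {p})" by simp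
        also have "\<dots> = e" using Ssum sum.remove[OF fin p, of "\<lambda>x. x"] by simp
        finally show "\<Sum>T = e" .
      qed
      ultimately show False using S(2)[of T] by simp
    qed
    then show "minimal_projection_in e p"
      using p Se S0 Sproj by (auto simp: minimal_projection_in_def)
  qed
qed

text \<open>A projection below \<open>p\<close> lies in every corner containing \<open>p\<close>, so
  minimality does not depend on the corner.\<close>

lemma minimal_projection_in_one:
  assumes "projection e" "minimal_projection_in e p"
  shows "minimal_projection_in 1 p"
proof -
  have p: "p \<in> corner e" "projection p" using assms(2) by (auto simp: minimal_projection_in_def)
  have "q \<in> corner e" if "projection q" "q * p = q" for q
  proof -
    have "p * q = q" using that p(2) by (metis projection_star star_mult)
    then show ?thesis using that p(1) by (simp add: corner_iff assms(1)) (metis mult.assoc)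
  qed
  then show ?thesis using assms(2) by (auto simp: minimal_projection_in_def)
qed

text \<open>Spectral projections of a self-adjoint element of \<open>corner p\<close> lie below
  \<open>p\<close>, hence are 0 or \<open>p\<close>, so the element is a multiple of
  \<open>p\<close>. Real and imaginary parts give the general case.\<close>

lemma minimal_projection_scalar:
  fixes p :: "'a::fd_cstar_algebra"
  assumes "minimal_projection_in 1 p"
  obtains c where "p * x * p = c *\<^sub>C p"
proof -
  have p: "projection p" and min: "\<And>q. projection q \<Longrightarrow> q * p = q \<Longrightarrow> q = 0 \<or> q = p"
    using assms by (auto simp: minimal_projection_in_def)
  have sa: "\<exists>c. h = c *\<^sub>C p" if h: "star h = h" "h \<in> corner p" for h
  proof -
    obtain L r where L: "orthogonal_projections L r" "\<And>l. l \<in> L \<Longrightarrow> r l \<in> corner p"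
      "h = (\<Sum>l\<in>L. l *\<^sub>R r l)"
      using spectral_theorem[OF h(1) p h(2)] by metis
    have "\<exists>c. l *\<^sub>R r l = c *\<^sub>C p" if "l \<in> L" for l
    proof -
      have "r l = 0 \<or> r l = p"
        using min[of "r l"] L(1) L(2)[OF that] that
        by (auto simp: orthogonal_projections_def corner_iff[OF p])
      then show ?thesis by (metis cvs.scale_zero_left scaleR_scaleC scaleR_zero_right)
    qed
    then obtain c where "\<And>l. l \<in> L \<Longrightarrow> l *\<^sub>R r l = c l *\<^sub>C p" by metis
    then have "h = (\<Sum>l\<in>L. c l) *\<^sub>C p" using L(3) by (simp add: cvs.scale_sum_left)
    then show ?thesis by blast
  qed
  define y where "y = p * x * p"
  define h where "h = y + star y"
  define k where "k = \<i> *\<^sub>C (star y - y)"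
  have y: "y \<in> corner p" "star y \<in> corner p"
    using projection_star[OF p] by (auto simp: y_def corner_compress star_mult mult.assoc corner_def)
  have my: "- y \<in> corner p" using corner_scaleR[OF y(1), of "-1"] by simp
  have "h \<in> corner p" "k \<in> corner p"
    using corner_add[OF y] corner_scaleC[OF corner_add[OF y(2) my], of \<i>] by (simp_all add: h_def k_def)
  moreover have "star h = h" "star k = k"
    by (simp_all add: h_def k_def star_add star_scaleC star_diff cvs.scale_right_diff_distrib)
  ultimately obtain c d where cd: "h = c *\<^sub>C p" "k = d *\<^sub>C p" using sa by metis
  have "h + \<i> *\<^sub>C k = 2 *\<^sub>C y"
    by (simp add: h_def k_def cvs.scale_right_diff_distrib flip: scaleC_add_left[of 1 1 y, simplified])
  then have "2 *\<^sub>C y = (c + \<i> * d) *\<^sub>C p" by (simp add: cd scaleC_add_left)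
  then have "(1/2) *\<^sub>C 2 *\<^sub>C y = ((c + \<i> * d) / 2) *\<^sub>C p" by simp
  then have "p * x * p = ((c + \<i> * d) / 2) *\<^sub>C p" by (simp add: y_def)
  then show thesis by (rule that)
qed

text \<open>For minimal \<open>p\<close>, the diagonal entry of \<open>x\<close> at
  \<open>p\<close>. In retrospect it is the trace of \<open>p * x\<close>, but it is available
  earlier and serves to construct the trace.\<close>

definition coefficient :: "'a::cstar_algebra \<Rightarrow> 'a \<Rightarrow> complex" where
  "coefficient p x = (SOME c. p * x * p = c *\<^sub>C p)"

lemma coefficient:
  fixes p :: "'a::fd_cstar_algebra"
  assumes "minimal_projection_in 1 p"
  shows "p * x * p = coefficient p x *\<^sub>C p"
proof -
  obtain c where "p * x * p = c *\<^sub>C p" by (rule minimal_projection_scalar[OF assms])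
  then show ?thesis unfolding coefficient_def by (rule someI)
qed

lemma coefficient_eqI:
  fixes p :: "'a::fd_cstar_algebra"
  assumes "minimal_projection_in 1 p" "p * x * p = c *\<^sub>C p"
  shows "coefficient p x = c"
  using coefficient[OF assms(1), of x] assms by (auto simp: minimal_projection_in_def)

text \<open>With \<open>u = p * x * q\<close> and \<open>w = q * y * p\<close>, the products
  \<open>u * w\<close> and \<open>w * u\<close> are multiples of \<open>p\<close> and
  \<open>q\<close>. Evaluating \<open>u * w * u\<close> in two ways identifies the scalars unless
  \<open>u = 0\<close>, when both vanish.\<close>

lemma coefficient_swap:
  fixes p q :: "'a::fd_cstar_algebra"
  assumes p: "minimal_projection_in 1 p" and q: "minimal_projection_in 1 q"
  shows "coefficient p (x * q * y) = coefficient q (y * p * x)"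
proof -
  define u where "u = p * x * q"
  define w where "w = q * y * p"
  have pp: "p * p = p" "q * q = q" "p \<noteq> 0" "q \<noteq> 0"
    using p q by (auto simp: minimal_projection_in_def projection_idem)
  then have pp': "p * (p * z) = p * z" "q * (q * z) = q * z" for z by (simp_all flip: mult.assoc)
  have uw: "u * w = coefficient p (x * q * y) *\<^sub>C p"
    using coefficient[OF p, of "x * q * y"] by (simp add: u_def w_def mult.assoc pp')
  have wu: "w * u = coefficient q (y * p * x) *\<^sub>C q"
    using coefficient[OF q, of "y * p * x"] by (simp add: u_def w_def mult.assoc pp')
  have "p * u = u" "u * q = u" by (simp_all add: u_def mult.assoc pp pp')
  then have "coefficient p (x * q * y) *\<^sub>C u = coefficient q (y * p * x) *\<^sub>C u"
    using uw wu by (metis mult.assoc mult_scaleC_left mult_scaleC_right)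
  moreover have ?thesis if "u = 0" using uw wu pp that by simp
  ultimately show ?thesis by auto
qed

text \<open>Existence of the trace, without a decomposition into matrix blocks. Inserting
  \<open>\<Sum>S = 1\<close> into a product reduces cyclicity to \<open>coefficient_swap\<close>;
  for minimal \<open>q\<close> the same swap turns the sum into the entry of 1 at
  \<open>q\<close>.\<close>

lemma is_trace_on_sum_coefficient:
  fixes S :: "'a::fd_cstar_algebra set"
  assumes S: "orthogonal_projections S (\<lambda>p. p)" "\<And>p. p \<in> S \<Longrightarrow> minimal_projection_in 1 p"
    "\<Sum>S = 1"
  shows "is_trace_on 1 (\<lambda>x. \<Sum>p\<in>S. coefficient p x)"
proof -
  have add: "coefficient p (x + y) = coefficient p x + coefficient p y" if "p \<in> S" for p x y
    using coefficient[OF S(2)[OF that]]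
    by (intro coefficient_eqI[OF S(2)[OF that]]) (simp add: algebra_simps scaleC_add_left)
  have scale: "coefficient p (c *\<^sub>C x) = c * coefficient p x" if "p \<in> S" for p c x
    using coefficient[OF S(2)[OF that], of x] by (intro coefficient_eqI[OF S(2)[OF that]]) simp
  have sum: "coefficient p (\<Sum>q\<in>S. f q) = (\<Sum>q\<in>S. coefficient p (f q))" if "p \<in> S" for p f
    by (rule coefficient_eqI[OF S(2)[OF that]])
      (simp add: sum_distrib_left sum_distrib_right coefficient[OF S(2)[OF that]] cvs.scale_sum_left)
  have expand: "coefficient p (x * y) = (\<Sum>q\<in>S. coefficient p (x * q * y))" if "p \<in> S" for p x y
  proof -
    have "x * y = (\<Sum>q\<in>S. x * q * y)"
      by (simp add: S(3) flip: sum_distrib_left sum_distrib_right)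
    then show ?thesis using sum[OF that] by metis
  qed
  have "(\<Sum>p\<in>S. coefficient p (x * y)) = (\<Sum>p\<in>S. coefficient p (y * x))" for x y
  proof -
    have "(\<Sum>p\<in>S. coefficient p (x * y)) = (\<Sum>p\<in>S. \<Sum>q\<in>S. coefficient p (x * q * y))"
      by (rule sum.cong[OF refl expand])
    also have "\<dots> = (\<Sum>p\<in>S. \<Sum>q\<in>S. coefficient q (y * p * x))"
      by (intro sum.cong refl coefficient_swap S(2))
    also have "\<dots> = (\<Sum>q\<in>S. \<Sum>p\<in>S. coefficient q (y * p * x))" by (rule sum.swap)
    also have "\<dots> = (\<Sum>q\<in>S. coefficient q (y * x))"
      by (rule sum.cong[OF refl expand[symmetric]])
    finally show ?thesis .
  qed
  moreover have "(\<Sum>p\<in>S. coefficient p q) = 1" if q: "minimal_projection_in 1 q" for q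
  proof -
    have qq: "q * q = q" "q \<noteq> 0" using q by (auto simp: minimal_projection_in_def projection_idem)
    have "coefficient p q = coefficient q p" if "p \<in> S" for p
    proof -
      have "coefficient p (1 * q * 1) = coefficient q (1 * p * 1)"
        by (rule coefficient_swap[OF S(2)[OF that] q])
      then show ?thesis by simp
    qed
    then have "(\<Sum>p\<in>S. coefficient p q) *\<^sub>C q = (\<Sum>p\<in>S. q * p * q)"
      by (simp add: cvs.scale_sum_left coefficient[OF q])
    also have "\<dots> = 1 *\<^sub>C q" using qq by (simp add: S(3) flip: sum_distrib_left sum_distrib_right)
    finally show ?thesis using qq(2) cvs.scale_right_imp_eq by blast
  qed
  ultimately show ?thesis
    by (simp add: is_trace_on_def add scale sum.distrib sum_distrib_left)
qed

lemma is_trace_on_sum: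
  assumes "is_trace_on e t" "\<And>i. i \<in> I \<Longrightarrow> f i \<in> corner e"
  shows "t (\<Sum>i\<in>I. f i) = (\<Sum>i\<in>I. t (f i))"
proof -
  have "t (0 *\<^sub>C 0) = 0 * t 0" using assms(1) corner_0 unfolding is_trace_on_def by blast
  then have "t 0 = 0" by simp
  then show ?thesis
    using assms by (induction I rule: infinite_finite_induct)
      (simp_all add: is_trace_on_def corner_sum)
qed

lemma corner_mult:
  assumes "projection e" "x \<in> corner e" "y \<in> corner e"
  shows "x * y \<in> corner e"
  using assms by (simp add: corner_iff) (metis mult.assoc)

text \<open>Any trace sends \<open>p * x\<close> to its value at \<open>p * x * p\<close>, which is
  the coefficient of \<open>x\<close> at \<open>p\<close>; summing over a minimal resolution of
  \<open>e\<close> forces the value at \<open>x\<close>.\<close>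

lemma is_trace_on_unique:
  fixes e :: "'a::fd_cstar_algebra"
  assumes e: "projection e" and t: "is_trace_on e t" "is_trace_on e s" and x: "x \<in> corner e"
  shows "t x = s x"
proof -
  obtain S where S: "orthogonal_projections S (\<lambda>p. p)"
    "\<And>p. p \<in> S \<Longrightarrow> minimal_projection_in e p" "\<Sum>S = e"
    using minimal_projections_sum[OF e] by blast
  have "u x = (\<Sum>p\<in>S. coefficient p x)" if u: "is_trace_on e u" for u
  proof -
    have p: "p * p = p" "p \<in> corner e" "u p = 1" if "p \<in> S" for p
      using S(2)[OF that] u by (auto simp: minimal_projection_in_def projection_idem is_trace_on_def)
    have "x = (\<Sum>p\<in>S. p * x)"
      using x S(3) by (simp add: corner_iff[OF e] flip: sum_distrib_right)
    then have "u x = (\<Sum>p\<in>S. u (p * x))"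
      using is_trace_on_sum[OF u, of S "\<lambda>p. p * x"] corner_mult[OF e p(2) x] by simp
    also have "\<dots> = (\<Sum>p\<in>S. coefficient p x)"
    proof (rule sum.cong)
      fix p assume pS: "p \<in> S"
      have "u (p * x) = u (p * (p * x))" using p(1)[OF pS] by (simp flip: mult.assoc)
      also have "\<dots> = u (p * x * p)"
        using u p(2)[OF pS] corner_mult[OF e p(2)[OF pS] x] unfolding is_trace_on_def by blast
      also have "p * x * p = coefficient p x *\<^sub>C p"
        by (rule coefficient[OF minimal_projection_in_one[OF e S(2)[OF pS]]])
      also have "u \<dots> = coefficient p x * u p"
        using u p(2)[OF pS] unfolding is_trace_on_def by blast
      finally show "u (p * x) = coefficient p x" using p(3)[OF pS] by simp
    qed simp
    finally show ?thesis .
  qed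
  from this[OF t(1)] this[OF t(2)] show ?thesis by simp
qed

lemma Tr_eq:
  fixes e :: "'a::fd_cstar_algebra"
  assumes e: "projection e" and t: "is_trace_on e t" and x: "x \<in> corner e"
  shows "Tr e x = t x"
proof -
  have "Tr e = restrict t (corner e)"
    unfolding Tr_def
  proof (rule the_equality)
    have [simp]: "p \<in> corner e" if "minimal_projection_in e p" for p
      using that by (simp add: minimal_projection_in_def)
    show "is_trace_on e (restrict t (corner e)) \<and> restrict t (corner e) \<in> extensional (corner e)"
      using t by (simp add: is_trace_on_def corner_add corner_scaleC corner_mult[OF e])
    fix s assume "is_trace_on e s \<and> s \<in> extensional (corner e)"
    then show "s = restrict t (corner e)"
      using is_trace_on_unique[OF e _ t] by (intro extensionalityI[of _ "corner e"]) auto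
  qed
  then show ?thesis using x by simp
qed

lemma is_trace_on_Tr: "is_trace_on 1 (Tr (1::'a::fd_cstar_algebra))"
proof -
  obtain S where S: "orthogonal_projections S (\<lambda>p. p)"
    "\<And>p. p \<in> S \<Longrightarrow> minimal_projection_in (1::'a) p" "\<Sum>S = 1"
    using minimal_projections_sum[OF projection_one] by blast
  have t: "is_trace_on 1 (\<lambda>x. \<Sum>p\<in>S. coefficient p x)" by (rule is_trace_on_sum_coefficient[OF S])
  then show ?thesis using Tr_eq[OF projection_one t] by (simp add: is_trace_on_def)
qed

text \<open>The trace of the whole algebra restricts to a trace of the corner, because minimal
  projections of the corner stay minimal.\<close>

lemma Tr_corner:
  fixes e :: "'a::fd_cstar_algebra"
  assumes "projection e" "x \<in> corner e"
  shows "Tr e x = Tr 1 x"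
  by (rule Tr_eq[OF assms(1) _ assms(2)])
    (use is_trace_on_Tr[where 'a='a] minimal_projection_in_one[OF assms(1)] in \<open>simp add: is_trace_on_def\<close>)

subsection \<open>Positivity of the trace\<close>

text \<open>If \<open>r < 0\<close>, some combination \<open>z = \<alpha> p + \<beta> y\<close> has \<open>z\<^sup>* z = 0\<close>: take \<open>\<bar>\<beta>\<bar> = 1\<close> making the cross terms
  cancel and \<open>\<alpha> = sqrt (- r)\<close>.\<close>

lemma minimal_projection_not_negative:
  fixes p y :: "'a::fd_cstar_algebra"
  assumes p: "minimal_projection_in 1 p" and y: "y * p = y" "star y * y = of_real r *\<^sub>C p"
  shows "r \<ge> 0"
proof (rule ccontr)
  assume "\<not> r \<ge> 0"
  then have r: "r < 0" by simp
  have pp: "p * p = p" "star p = p" "p \<noteq> 0"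
    using p by (auto simp: minimal_projection_in_def projection_def)
  have py: "p * star y = star y" using y(1) pp(2) by (metis star_mult)
  define \<mu> where "\<mu> = coefficient p y"
  have pyp: "p * y = \<mu> *\<^sub>C p"
    using coefficient[OF p, of y] y(1) by (simp add: \<mu>_def mult.assoc)
  then have ypp: "star y * p = cnj \<mu> *\<^sub>C p" using pp(2) by (metis star_mult star_scaleC)
  \<comment> \<open>The cross terms of \<open>star z * z\<close> are
    \<open>\<alpha> * (\<beta> * \<mu> + cnj (\<beta> * \<mu>))\<close> times \<open>p\<close>, so
    \<open>\<beta>\<close> must make \<open>\<beta> * \<mu>\<close> purely imaginary.\<close>
  define \<beta> where "\<beta> = (if \<mu> = 0 then 1 else \<i> * cnj (sgn \<mu>))"
  have "cmod \<beta> = 1" by (simp add: \<beta>_def norm_mult norm_sgn)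
  then have \<beta>: "cnj \<beta> * \<beta> = 1" using complex_norm_square[of \<beta>] by (simp add: mult.commute)
  have \<beta>\<mu>: "\<beta> * \<mu> + cnj (\<beta> * \<mu>) = 0"
  proof (cases "\<mu> = 0")
    case False
    have "cnj (sgn \<mu>) * \<mu> = of_real (cmod \<mu>)"
      using False complex_norm_square[of \<mu>]
      by (simp add: sgn_eq field_simps power2_eq_square)
    then have "\<beta> * \<mu> = \<i> * of_real (cmod \<mu>)" using False by (simp add: \<beta>_def mult.assoc)
    then show ?thesis by simp
  qed simp
  define \<alpha> where "\<alpha> = complex_of_real (sqrt (- r))"
  have \<alpha>: "\<alpha> * \<alpha> = - of_real r" "cnj \<alpha> = \<alpha>"
    using r by (simp_all add: \<alpha>_def flip: of_real_mult)
  have "star (\<alpha> *\<^sub>C p + \<beta> *\<^sub>C y) * (\<alpha> *\<^sub>C p + \<beta> *\<^sub>C y) =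
      (\<alpha> * \<alpha>) *\<^sub>C p + (\<alpha> * (\<beta> * \<mu>)) *\<^sub>C p + (\<alpha> * cnj (\<beta> * \<mu>)) *\<^sub>C p + (cnj \<beta> * \<beta> * of_real r) *\<^sub>C p"
    using \<alpha>(2) by (simp add: star_add star_scaleC distrib_left distrib_right scaleC_add_right pp pyp ypp y(2) ac_simps)
  also have "\<dots> = (\<alpha> * \<alpha> + \<alpha> * (\<beta> * \<mu> + cnj (\<beta> * \<mu>)) + cnj \<beta> * \<beta> * of_real r) *\<^sub>C p"
    by (simp add: scaleC_add_left distrib_left)
  also have "\<dots> = 0" unfolding \<beta>\<mu> \<beta> \<alpha> by simp
  finally have "\<alpha> *\<^sub>C p + \<beta> *\<^sub>C y = 0" by simp
  \<comment> \<open>No contradiction yet: the combination may simply be 0. But then \<open>y\<close>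
    is a multiple of \<open>p\<close> with \<open>star y * y\<close> equal to \<open>- r\<close>
    times \<open>p\<close>, and comparison with the hypothesis gives \<open>r = - r\<close>.\<close>
  then have "cnj \<beta> *\<^sub>C (\<alpha> *\<^sub>C p + \<beta> *\<^sub>C y) = 0" by simp
  then have "y = - ((cnj \<beta> * \<alpha>) *\<^sub>C p)"
    using \<beta> by (simp add: scaleC_add_right eq_neg_iff_add_eq_0 add.commute)
  then have "star y * y = (cnj \<beta> * \<beta> * (\<alpha> * \<alpha>)) *\<^sub>C p"
    using \<alpha>(2) pp by (simp add: star_scaleC mult.commute mult.left_commute)
  then have "of_real r *\<^sub>C p = (- of_real r) *\<^sub>C p" using y(2) \<beta> \<alpha>(1) by simp
  then have "complex_of_real r = - of_real r" using pp(3) by (simp only: cvs.scale_cancel_right) simp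
  then have "r = - r" by (metis of_real_eq_iff of_real_minus)
  then show False using r by simp
qed

lemma coefficient_star_mult_self:
  fixes p x :: "'a::fd_cstar_algebra"
  assumes "minimal_projection_in 1 p"
  obtains r where "coefficient p (star x * x) = of_real r" "r \<ge> 0" "r = 0 \<Longrightarrow> x * p = 0"
proof -
  define y where "y = x * p"
  define c where "c = coefficient p (star x * x)"
  have p: "p * p = p" "star p = p" "p \<noteq> 0"
    using assms by (auto simp: minimal_projection_in_def projection_def)
  have yy: "star y * y = c *\<^sub>C p"
    using coefficient[OF assms, of "star x * x"] p by (simp add: y_def c_def star_mult mult.assoc)
  have "star (star y * y) = star y * y" by (simp add: star_mult)
  then have "cnj c *\<^sub>C p = c *\<^sub>C p" by (simp add: yy star_scaleC p)
  then have "c \<in> \<real>" using p(3) Reals_cnj_iff by auto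
  then obtain r where r: "c = of_real r" by (auto elim: Reals_cases)
  have "y * p = y" using p by (simp add: y_def mult.assoc)
  then have "r \<ge> 0" using minimal_projection_not_negative[OF assms, of y r] yy r by simp
  moreover have "x * p = 0" if "r = 0" using yy that r by (simp add: y_def)
  ultimately show thesis using that r by (simp add: c_def)
qed

definition tr :: "'a::cstar_algebra \<Rightarrow> real" where
  "tr x = Re (Tr 1 x)"

lemma Tr_add: "Tr 1 (x + y) = Tr 1 x + Tr 1 (y::'a::fd_cstar_algebra)"
  and Tr_scaleC: "Tr 1 (c *\<^sub>C x) = c * Tr 1 x"
  and Tr_mult_commute: "Tr 1 (x * y) = Tr 1 (y * x)"
  and Tr_minimal: "minimal_projection_in 1 p \<Longrightarrow> Tr 1 (p::'a) = 1"
  using is_trace_on_Tr[where 'a='a] by (auto simp: is_trace_on_def)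

lemma tr_add: "tr (x + y) = tr x + tr (y::'a::fd_cstar_algebra)"
  by (simp add: tr_def Tr_add)

lemma tr_scaleR: "tr (r *\<^sub>R x) = r * tr (x::'a::fd_cstar_algebra)"
  by (simp add: tr_def scaleR_scaleC Tr_scaleC)

lemma tr_mult_commute: "tr (x * y) = tr (y * (x::'a::fd_cstar_algebra))"
  by (simp add: tr_def Tr_mult_commute[of x y])

lemma tr_0 [simp]: "tr (0::'a::fd_cstar_algebra) = 0"
  using tr_scaleR[of 0 "0::'a"] by simp

lemma tr_sum: "tr (\<Sum>i\<in>I. f i) = (\<Sum>i\<in>I. tr (f i :: 'a::fd_cstar_algebra))"
  by (induction I rule: infinite_finite_induct) (simp_all add: tr_add)

lemma Tr_star_mult_self:
  fixes x :: "'a::fd_cstar_algebra"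
  shows "Tr 1 (star x * x) = of_real (tr (star x * x))" "0 \<le> tr (star x * x)"
    "tr (star x * x) = 0 \<Longrightarrow> x = 0"
proof -
  obtain S where S: "orthogonal_projections S (\<lambda>p. p)"
    "\<And>p. p \<in> S \<Longrightarrow> minimal_projection_in (1::'a) p" "\<Sum>S = 1"
    using minimal_projections_sum[OF projection_one] by blast
  have fin: "finite S" using S(1) by (simp add: orthogonal_projections_def)
  have "\<exists>r. coefficient p (star x * x) = of_real r \<and> r \<ge> 0 \<and> (r = 0 \<longrightarrow> x * p = 0)"
    if "p \<in> S" for p
    using coefficient_star_mult_self[OF S(2)[OF that]] by metis
  then obtain r where r: "\<And>p. p \<in> S \<Longrightarrow> coefficient p (star x * x) = of_real (r p)"
    "\<And>p. p \<in> S \<Longrightarrow> r p \<ge> 0" "\<And>p. p \<in> S \<Longrightarrow> r p = 0 \<Longrightarrow> x * p = 0"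
    by metis
  have Tr: "Tr 1 (star x * x) = of_real (\<Sum>p\<in>S. r p)"
    using Tr_eq[OF projection_one is_trace_on_sum_coefficient[OF S]] r(1) by simp
  then have tr: "tr (star x * x) = (\<Sum>p\<in>S. r p)" by (simp add: tr_def)
  show "Tr 1 (star x * x) = of_real (tr (star x * x))" using Tr tr by simp
  show "0 \<le> tr (star x * x)" using tr r(2) by (simp add: sum_nonneg)
  assume "tr (star x * x) = 0"
  then have "\<And>p. p \<in> S \<Longrightarrow> x * p = 0" using tr r(2,3) fin by (simp add: sum_nonneg_eq_0_iff)
  moreover have "x = (\<Sum>p\<in>S. x * p)" by (simp add: S(3) flip: sum_distrib_left)
  ultimately show "x = 0" by simp
qed

section \<open>Positive elements and the trace\<close>

abbreviation (input) positive :: "'a::cstar_algebra \<Rightarrow> bool" where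
  "positive \<equiv> positive_in 1"

lemma positive_def: "positive a \<longleftrightarrow> (\<exists>b. a = star b * b)"
  by (simp add: positive_in_def)

lemma positive_star: "positive a \<Longrightarrow> star a = a"
  by (auto simp: positive_def star_mult)

lemma positive_compress: "positive a \<Longrightarrow> positive (star x * a * x)"
  unfolding positive_def by (metis mult.assoc star_mult)

lemma positive_compress_projection: "positive a \<Longrightarrow> projection p \<Longrightarrow> positive (p * a * p)"
  using positive_compress[of a p] by (simp add: projection_star)

lemma projection_positive: "projection p \<Longrightarrow> positive p"
  unfolding positive_def by (metis projection_def)

lemma Tr_positive: "positive a \<Longrightarrow> Tr 1 a = of_real (tr (a::'a::fd_cstar_algebra))"
  using Tr_star_mult_self(1) by (auto simp: positive_def)

lemma tr_nonneg: "positive a \<Longrightarrow> 0 \<le> tr (a::'a::fd_cstar_algebra)"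
  using Tr_star_mult_self(2) by (auto simp: positive_def)

lemma tr_eq_0: "positive a \<Longrightarrow> tr a = 0 \<Longrightarrow> (a::'a::fd_cstar_algebra) = 0"
  using Tr_star_mult_self(3) by (auto simp: positive_def)

text \<open>The trace counts the members of a minimal resolution of \<open>p\<close>. Hence traces
  of spectral projections are strictly positive and eigenvalues of states are at most 1.\<close>

lemma tr_projection_ge_1:
  fixes p :: "'a::fd_cstar_algebra"
  assumes "projection p" "p \<noteq> 0"
  shows "tr p \<ge> 1"
proof -
  obtain S where S: "orthogonal_projections S (\<lambda>p. p)"
    "\<And>q. q \<in> S \<Longrightarrow> minimal_projection_in p q" "\<Sum>S = p"
    using minimal_projections_sum[OF assms(1)] by blast
  have fin: "finite S" using S(1) by (simp add: orthogonal_projections_def)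
  have "tr p = (\<Sum>q\<in>S. tr q)" using S(3) tr_sum[of "\<lambda>q. q" S] by simp
  also have "\<dots> = (\<Sum>q\<in>S. 1)"
  proof (rule sum.cong)
    fix q assume "q \<in> S"
    then show "tr q = 1"
      using Tr_minimal[OF minimal_projection_in_one[OF assms(1) S(2)]] by (simp add: tr_def)
  qed simp
  finally have "tr p = card S" by simp
  moreover have "S \<noteq> {}" using S(3) assms(2) by auto
  ultimately show ?thesis using fin by (simp add: Suc_le_eq card_gt_0_iff)
qed

lemma tr_mult_projection:
  fixes a :: "'a::fd_cstar_algebra"
  assumes "projection q"
  shows "tr (a * q) = tr (q * a * q)"
  using tr_mult_commute[of "a * q" q] assms by (simp add: mult.assoc projection_idem)

lemma tr_mult_projection_nonneg:
  fixes a :: "'a::fd_cstar_algebra"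
  assumes "positive a" "projection q"
  shows "0 \<le> tr (a * q)"
  using tr_nonneg[OF positive_compress_projection[OF assms]] tr_mult_projection[OF assms(2)] by simp

text \<open>Each eigenvalue is tested against its own projection, as
  \<open>tr (a * p l) = l * tr (p l)\<close>. The hypothesis is a trace condition instead of
  positivity so that it can yield the trace criterion for positivity.\<close>

lemma spectral_theorem_nonneg:
  fixes a :: "'a::fd_cstar_algebra"
  assumes "star a = a" "\<And>q. projection q \<Longrightarrow> 0 \<le> tr (a * q)" "projection e" "a \<in> corner e"
  obtains L p where "orthogonal_projections L p" "\<And>l. l \<in> L \<Longrightarrow> p l \<in> corner e"
    "\<And>l. l \<in> L \<Longrightarrow> p l \<noteq> 0" "\<And>l. l \<in> L \<Longrightarrow> l \<ge> 0" "(\<Sum>l\<in>L. p l) = e" "a = (\<Sum>l\<in>L. l *\<^sub>R p l)"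
proof -
  obtain L p where L: "orthogonal_projections L p" "\<And>l. l \<in> L \<Longrightarrow> p l \<in> corner e"
    "\<And>l. l \<in> L \<Longrightarrow> p l \<noteq> 0" "(\<Sum>l\<in>L. p l) = e" "a = (\<Sum>l\<in>L. l *\<^sub>R p l)"
    using spectral_theorem[OF assms(1,3,4)] by metis
  have "l \<ge> 0" if "l \<in> L" for l
  proof -
    have p: "projection (p l)" using L(1) that by (simp add: orthogonal_projections_def)
    have "a * p l = l *\<^sub>R p l"
      unfolding L(5) by (rule sum_mult_orthogonal_projections[OF L(1) that])
    then have "0 \<le> l * tr (p l)" using assms(2)[OF p] by (simp add: tr_scaleR)
    moreover have "tr (p l) > 0" using tr_projection_ge_1[OF p L(3)[OF that]] by simp
    ultimately show ?thesis by (simp add: zero_le_mult_iff)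
  qed
  then show thesis using that[OF L(1-3)] L(4,5) by blast
qed

lemma spectral_theorem_positive:
  fixes a :: "'a::fd_cstar_algebra"
  assumes "positive a" "projection e" "a \<in> corner e"
  obtains L p where "orthogonal_projections L p" "\<And>l. l \<in> L \<Longrightarrow> p l \<in> corner e"
    "\<And>l. l \<in> L \<Longrightarrow> p l \<noteq> 0" "\<And>l. l \<in> L \<Longrightarrow> l \<ge> 0" "(\<Sum>l\<in>L. p l) = e" "a = (\<Sum>l\<in>L. l *\<^sub>R p l)"
  using spectral_theorem_nonneg[OF positive_star[OF assms(1)] tr_mult_projection_nonneg[OF assms(1)] assms(2,3)]
  by blast

lemma positive_in_sum:
  assumes "orthogonal_projections I p" "\<And>i. i \<in> I \<Longrightarrow> p i \<in> corner e" "\<And>i. i \<in> I \<Longrightarrow> v i \<ge> 0"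
  shows "positive_in e (\<Sum>i\<in>I. v i *\<^sub>R p i)"
proof -
  let ?b = "\<Sum>i\<in>I. sqrt (v i) *\<^sub>R p i"
  have "star ?b * ?b = (\<Sum>i\<in>I. v i *\<^sub>R p i)"
    unfolding star_sum_projections[OF assms(1)] sum_mult_sum_orthogonal_projections[OF assms(1)]
    using assms(3) by (intro sum.cong) auto
  moreover have "?b \<in> corner e" by (intro corner_sum corner_scaleR assms(2))
  ultimately show ?thesis unfolding positive_in_def by metis
qed

lemma positive_in_iff:
  fixes a :: "'a::fd_cstar_algebra"
  assumes "projection e"
  shows "positive_in e a \<longleftrightarrow> positive a \<and> a \<in> corner e"
proof
  assume "positive_in e a"
  then obtain b where b: "b \<in> corner e" "a = star b * b" by (auto simp: positive_in_def)
  have "e * star b = star b" using b(1) assms by (metis corner_iff projection_star star_mult)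
  then show "positive a \<and> a \<in> corner e"
    using b by (auto simp: positive_def corner_iff[OF assms] mult.assoc) (metis mult.assoc)
next
  assume a: "positive a \<and> a \<in> corner e"
  obtain L p where L: "orthogonal_projections L p" "\<And>l. l \<in> L \<Longrightarrow> p l \<in> corner e"
    "\<And>l. l \<in> L \<Longrightarrow> l \<ge> 0" "a = (\<Sum>l\<in>L. l *\<^sub>R p l)"
    using spectral_theorem_positive[OF conjunct1[OF a] assms conjunct2[OF a]] by metis
  then show "positive_in e a" using positive_in_sum[OF L(1,2)] by simp
qed

text \<open>Trades the quadratic form \<open>star b * b\<close> for linear conditions, which visibly
  pass to sums.\<close>

lemma positive_iff_tr:
  fixes a :: "'a::fd_cstar_algebra"
  shows "positive a \<longleftrightarrow> star a = a \<and> (\<forall>q. projection q \<longrightarrow> 0 \<le> tr (a * q))"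
proof (intro iffI conjI)
  assume a: "star a = a \<and> (\<forall>q. projection q \<longrightarrow> 0 \<le> tr (a * q))"
  have "a \<in> corner 1" by simp
  then obtain L p where L: "orthogonal_projections L p" "\<And>l. l \<in> L \<Longrightarrow> p l \<in> corner 1"
    "\<And>l. l \<in> L \<Longrightarrow> l \<ge> 0" "a = (\<Sum>l\<in>L. l *\<^sub>R p l)"
    using spectral_theorem_nonneg[OF conjunct1[OF a] _ projection_one, rule_format, OF conjunct2[OF a, rule_format]]
    by metis
  then show "positive a" using positive_in_sum[OF L(1,2)] by simp
qed (simp_all add: positive_star tr_mult_projection_nonneg)

lemma positive_0 [simp]: "positive 0"
  unfolding positive_def by (rule exI[of _ 0]) simp

lemma positive_add: "positive a \<Longrightarrow> positive b \<Longrightarrow> positive (a + (b::'a::fd_cstar_algebra))"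
  by (simp add: positive_iff_tr star_add distrib_right tr_add)

lemma positive_sum: "(\<And>i. i \<in> I \<Longrightarrow> positive (f i)) \<Longrightarrow> positive (\<Sum>i\<in>I. f i :: 'a::fd_cstar_algebra)"
  by (induction I rule: infinite_finite_induct) (auto intro: positive_add)

lemma positive_scaleR: "positive a \<Longrightarrow> r \<ge> 0 \<Longrightarrow> positive (r *\<^sub>R (a::'a::fd_cstar_algebra))"
  by (simp add: positive_iff_tr star_scaleR tr_scaleR)

lemma positive_sum_eq_0:
  fixes f :: "'i \<Rightarrow> 'a::fd_cstar_algebra"
  assumes "finite I" "\<And>i. i \<in> I \<Longrightarrow> positive (f i)" "(\<Sum>i\<in>I. f i) = 0" "i \<in> I"
  shows "f i = 0"
proof -
  have "(\<Sum>i\<in>I. tr (f i)) = 0" using assms(3) by (simp flip: tr_sum)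
  then have "tr (f i) = 0"
    using assms(1,4) sum_nonneg_eq_0_iff[of I "\<lambda>i. tr (f i)"] tr_nonneg[OF assms(2)] by blast
  then show ?thesis using tr_eq_0 assms by blast
qed

lemma eq_0_if_tr_mult_projection_eq_0:
  fixes a :: "'a::fd_cstar_algebra"
  assumes "star a = a" "\<And>q. projection q \<Longrightarrow> tr (a * q) = 0"
  shows "a = 0"
proof -
  have "positive a" using assms by (simp add: positive_iff_tr)
  then show ?thesis using tr_eq_0[of a] assms(2)[OF projection_one] by simp
qed

lemma states_iff:
  fixes a :: "'a::fd_cstar_algebra"
  assumes "projection e"
  shows "a \<in> states e \<longleftrightarrow> positive a \<and> a \<in> corner e \<and> tr a = 1"
  using Tr_corner[OF assms, of a] Tr_positive[of a]
  by (auto simp: states_def positive_in_iff[OF assms])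

text \<open>Compressing the sum by \<open>e j\<close> gives \<open>e j\<close> plus positive terms
  \<open>e j * e i * e j\<close>, which must vanish; each of them is
  \<open>star (e i * e j) * (e i * e j)\<close>.\<close>

lemma orthogonal_projections_if_sum_eq_1:
  fixes e :: "'i \<Rightarrow> 'a::fd_cstar_algebra"
  assumes fin: "finite I" and proj: "\<And>i. i \<in> I \<Longrightarrow> projection (e i)" and sum: "(\<Sum>i\<in>I. e i) = 1"
  shows "orthogonal_projections I e"
proof -
  have "e i * e j = 0" if ij: "i \<in> I" "j \<in> I" "i \<noteq> j" for i j
  proof -
    have "e j = e j * (\<Sum>i\<in>I. e i) * e j" using proj[OF ij(2)] sum by (simp add: projection_idem)
    also have "\<dots> = e j * e j * e j + (\<Sum>i\<in>I-{j}. e j * e i * e j)"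
      by (subst sum.remove[OF fin ij(2)]) (simp add: distrib_left distrib_right sum_distrib_left sum_distrib_right)
    finally have "(\<Sum>i\<in>I-{j}. e j * e i * e j) = 0"
      using proj[OF ij(2)] by (simp add: projection_idem)
    then have "e j * e i * e j = 0"
      using positive_sum_eq_0[of "I - {j}" "\<lambda>i. e j * e i * e j" i] fin ij proj
      by (auto intro: positive_compress_projection projection_positive)
    then have "star (e i * e j) * (e i * e j) = 0"
      using proj[OF ij(1)] proj[OF ij(2)]
      by (simp add: star_mult projection_star mult.assoc projection_idem_left)
    then show ?thesis by simp
  qed
  then show ?thesis using fin proj by (simp add: orthogonal_projections_def)
qed

lemma spectral_theorem_positive_one:
  fixes a :: "'a::fd_cstar_algebra"
  assumes "positive a"
  obtains L p where "orthogonal_projections L p" "\<And>l. l \<in> L \<Longrightarrow> p l \<noteq> 0"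
    "\<And>l. l \<in> L \<Longrightarrow> l \<ge> 0" "(\<Sum>l\<in>L. p l) = 1" "a = (\<Sum>l\<in>L. l *\<^sub>R p l)"
  by (rule spectral_theorem_positive[OF assms projection_one]) simp_all

subsection \<open>Entropy\<close>

lemma eta_0 [simp]: "eta 0 = 0"
  by (simp add: eta_def)

lemma eta_1 [simp]: "eta 1 = 0"
  by (simp add: eta_def)

lemma eta_mult: "0 \<le> w \<Longrightarrow> 0 \<le> l \<Longrightarrow> eta (w * l) = w * eta l + l * eta w"
  by (cases "w = 0 \<or> l = 0") (auto simp: eta_def ln_mult algebra_simps)

text \<open>The right side is the tangent of the concave function \<open>eta\<close> at
  \<open>m\<close>.\<close>

lemma eta_le_tangent:
  assumes "0 \<le> l" "0 < m"
  shows "eta l \<le> - l * ln m + m - l"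
proof (cases "l = 0")
  case False
  then have "l * ln (m / l) \<le> l * (m / l - 1)"
    using assms by (intro mult_left_mono ln_le_minus_one) auto
  then show ?thesis using False assms by (simp add: eta_def ln_div algebra_simps)
qed (use assms in simp)

lemma entropy_sum:
  fixes p :: "'i \<Rightarrow> 'a::fd_cstar_algebra"
  assumes "projection e" "orthogonal_projections I p" "\<And>i. i \<in> I \<Longrightarrow> p i \<in> corner e"
  shows "entropy e (\<Sum>i\<in>I. v i *\<^sub>R p i) = (\<Sum>i\<in>I. eta (v i) * tr (p i))"
proof -
  have "(\<Sum>i\<in>I. eta (v i) *\<^sub>R p i) \<in> corner e" by (intro corner_sum corner_scaleR assms(3))
  then have "entropy e (\<Sum>i\<in>I. v i *\<^sub>R p i) = tr (\<Sum>i\<in>I. eta (v i) *\<^sub>R p i)"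
    using functional_calculus_sum[where g=eta, OF assms eta_0]
    by (simp add: entropy_def tr_def Tr_corner[OF assms(1)])
  then show ?thesis by (simp add: tr_sum tr_scaleR)
qed

lemma entropy_sum_one:
  fixes p :: "'i \<Rightarrow> 'a::fd_cstar_algebra"
  assumes "orthogonal_projections I p"
  shows "entropy 1 (\<Sum>i\<in>I. v i *\<^sub>R p i) = (\<Sum>i\<in>I. eta (v i) * tr (p i))"
  by (rule entropy_sum[OF projection_one assms]) simp

text \<open>Enlarging the unit only adds the eigenvalue 0, and \<open>eta 0 = 0\<close>; so all
  entropies can be taken in the full algebra.\<close>

lemma entropy_corner:
  fixes a :: "'a::fd_cstar_algebra"
  assumes "projection e" "star a = a" "a \<in> corner e"
  shows "entropy e a = entropy 1 a"
proof -
  obtain L p where L: "orthogonal_projections L p" "\<And>l. l \<in> L \<Longrightarrow> p l \<in> corner e"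
    "a = (\<Sum>l\<in>L. l *\<^sub>R p l)"
    using spectral_theorem[OF assms(2,1,3)] by metis
  show ?thesis unfolding L(3) entropy_sum_one[OF L(1)] by (rule entropy_sum[OF assms(1) L(1,2)])
qed

lemma entropy_0 [simp]: "entropy 1 (0::'a::fd_cstar_algebra) = 0"
  using entropy_sum_one[of "{}" "\<lambda>_. 0::'a" "\<lambda>_. 0"] by (simp add: orthogonal_projections_def)

lemma entropy_scaleR:
  fixes a :: "'a::fd_cstar_algebra"
  assumes "positive a" "0 \<le> w"
  shows "entropy 1 (w *\<^sub>R a) = w * entropy 1 a + eta w * tr a"
proof -
  obtain L p where L: "orthogonal_projections L p" "\<And>l. l \<in> L \<Longrightarrow> l \<ge> 0"
    "a = (\<Sum>l\<in>L. l *\<^sub>R p l)"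
    using spectral_theorem_positive_one[OF assms(1)] by metis
  have "entropy 1 (w *\<^sub>R a) = entropy 1 (\<Sum>l\<in>L. (w * l) *\<^sub>R p l)"
    by (simp add: L(3) scaleR_sum_right)
  also have "\<dots> = (\<Sum>l\<in>L. (w * eta l + l * eta w) * tr (p l))"
    unfolding entropy_sum_one[OF L(1)] using L(2) assms(2) by (intro sum.cong) (auto simp: eta_mult)
  also have "\<dots> = w * (\<Sum>l\<in>L. eta l * tr (p l)) + eta w * (\<Sum>l\<in>L. l * tr (p l))"
    by (simp add: distrib_right sum.distrib sum_distrib_left mult.assoc mult.left_commute)
  also have "(\<Sum>l\<in>L. eta l * tr (p l)) = entropy 1 a" by (simp add: L(3) entropy_sum_one[OF L(1)])
  also have "(\<Sum>l\<in>L. l * tr (p l)) = tr a" by (simp add: L(3) tr_sum tr_scaleR)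
  finally show ?thesis .
qed

text \<open>Crude bounds meant to make capacities finite: the eigenvalues of a state lie in [0,1],
  where \<open>eta l\<close> lies between 0 and 1.\<close>

lemma entropy_bounds:
  fixes a :: "'a::fd_cstar_algebra"
  assumes "positive a" "tr a = 1"
  shows "0 \<le> entropy 1 a" "entropy 1 a \<le> tr (1::'a)"
proof -
  obtain L p where L: "orthogonal_projections L p" "\<And>l. l \<in> L \<Longrightarrow> l \<ge> 0"
    "\<And>l. l \<in> L \<Longrightarrow> p l \<noteq> 0" "(\<Sum>l\<in>L. p l) = 1" "a = (\<Sum>l\<in>L. l *\<^sub>R p l)"
    using spectral_theorem_positive_one[OF assms(1)] by metis
  have fin: "finite L" using L(1) by (simp add: orthogonal_projections_def)
  have p: "tr (p l) \<ge> 1" if "l \<in> L" for l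
    using tr_projection_ge_1[OF _ L(3)[OF that]] L(1) that by (simp add: orthogonal_projections_def)
  have "l \<le> 1" if "l \<in> L" for l
  proof -
    have "l * 1 \<le> l * tr (p l)" using p[OF that] L(2)[OF that] by (rule mult_left_mono)
    also have "\<dots> \<le> (\<Sum>l\<in>L. l * tr (p l))"
      using that fin L(2) p by (intro member_le_sum) (auto intro!: mult_nonneg_nonneg intro: order_trans[of 0 1])
    also have "\<dots> = 1" using assms(2) by (simp add: L(5) tr_sum tr_scaleR)
    finally show ?thesis by simp
  qed
  then have eta: "0 \<le> eta l" if "l \<in> L" for l
    using that L(2) by (auto simp: eta_def mult_nonneg_nonpos)
  have S: "entropy 1 a = (\<Sum>l\<in>L. eta l * tr (p l))" unfolding L(5) by (rule entropy_sum_one[OF L(1)])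
  show "0 \<le> entropy 1 a"
    unfolding S using eta p by (intro sum_nonneg mult_nonneg_nonneg) (auto intro: order_trans[of 0 1])
  have "eta l \<le> 1" if "l \<in> L" for l using eta_le_tangent[of l 1] L(2)[OF that] by simp
  then have "entropy 1 a \<le> (\<Sum>l\<in>L. 1 * tr (p l))"
    unfolding S using p by (intro sum_mono mult_right_mono) (auto intro: order_trans[of 0 1])
  then show "entropy 1 a \<le> tr (1::'a)" using tr_sum[of p L] L(4) by simp
qed

lemma orthogonal_projections_Sigma:
  assumes f: "orthogonal_projections I f"
    and p: "\<And>i. i \<in> I \<Longrightarrow> orthogonal_projections (L i) (p i)"
      "\<And>i l. i \<in> I \<Longrightarrow> l \<in> L i \<Longrightarrow> p i l \<in> corner (f i)"
  shows "orthogonal_projections (Sigma I L) (\<lambda>(i, l). p i l)"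
proof -
  have fin: "finite I" "\<And>i. i \<in> I \<Longrightarrow> finite (L i)"
    using f p(1) by (simp_all add: orthogonal_projections_def)
  have proj: "projection (p i l)" if "i \<in> I" "l \<in> L i" for i l
    using p(1) that by (simp add: orthogonal_projections_def)
  have "p i l * p j m = 0" if "i \<in> I" "j \<in> I" "l \<in> L i" "m \<in> L j" "i \<noteq> j \<or> l \<noteq> m" for i j l m
  proof (cases "i = j")
    case True
    then show ?thesis using orthogonal_projections_mult[OF p(1)] that by auto
  next
    case False
    have "projection (f i)" "projection (f j)" using f that by (simp_all add: orthogonal_projections_def)
    then have "p i l * f i = p i l" "f j * p j m = p j m"
      using p(2)[OF that(1,3)] p(2)[OF that(2,4)] by (simp_all add: corner_iff)
    then have "p i l * p j m = p i l * (f i * f j) * p j m" by (metis mult.assoc)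
    then show ?thesis using orthogonal_projections_mult[OF f that(1,2)] False by simp
  qed
  then show ?thesis using fin proj by (fastforce simp: orthogonal_projections_def)
qed

lemma entropy_orthogonal_sum:
  fixes b :: "'i \<Rightarrow> 'a::fd_cstar_algebra"
  assumes f: "orthogonal_projections I f"
    and b: "\<And>i. i \<in> I \<Longrightarrow> positive (b i)" "\<And>i. i \<in> I \<Longrightarrow> b i \<in> corner (f i)"
  shows "entropy 1 (\<Sum>i\<in>I. b i) = (\<Sum>i\<in>I. entropy 1 (b i))"
proof -
  have fin: "finite I" using f by (simp add: orthogonal_projections_def)
  have "\<exists>L p. orthogonal_projections L p \<and> (\<forall>l\<in>L. p l \<in> corner (f i)) \<and> b i = (\<Sum>l\<in>L. l *\<^sub>R p l)"
    if "i \<in> I" for i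
  proof -
    have "projection (f i)" using f that by (simp add: orthogonal_projections_def)
    from spectral_theorem[OF positive_star[OF b(1)[OF that]] this b(2)[OF that]]
    show ?thesis by metis
  qed
  then obtain L p where L: "\<And>i. i \<in> I \<Longrightarrow> orthogonal_projections (L i) (p i)"
    "\<And>i l. i \<in> I \<Longrightarrow> l \<in> L i \<Longrightarrow> p i l \<in> corner (f i)"
    "\<And>i. i \<in> I \<Longrightarrow> b i = (\<Sum>l\<in>L i. l *\<^sub>R p i l)"
    by metis
  have finL: "\<forall>i\<in>I. finite (L i)" using L(1) by (simp add: orthogonal_projections_def)
  have "(\<Sum>i\<in>I. b i) = (\<Sum>x\<in>Sigma I L. snd x *\<^sub>R (case x of (i, l) \<Rightarrow> p i l))"
    using L(3) by (simp add: sum.Sigma[OF fin finL] split_def)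
  then have "entropy 1 (\<Sum>i\<in>I. b i) = (\<Sum>x\<in>Sigma I L. eta (snd x) * tr (case x of (i, l) \<Rightarrow> p i l))"
    using entropy_sum_one[OF orthogonal_projections_Sigma[OF f L(1,2)], of snd] by simp
  also have "\<dots> = (\<Sum>i\<in>I. \<Sum>l\<in>L i. eta l * tr (p i l))"
    by (simp add: sum.Sigma[OF fin finL] split_def)
  also have "\<dots> = (\<Sum>i\<in>I. entropy 1 (b i))"
    using L(1,3) by (simp add: entropy_sum_one)
  finally show ?thesis .
qed

text \<open>Since \<open>ln 0 = 0\<close>, the condition at \<open>m j = 0\<close> is what remains of the requirement that
  the support of \<open>a\<close> be contained in that of \<open>\<Sum>j. m j *\<^sub>R q j\<close>.\<close>

lemma gibbs_inequality:
  fixes a :: "'a::fd_cstar_algebra"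
  assumes a: "positive a" and q: "orthogonal_projections J q" "(\<Sum>j\<in>J. q j) = 1"
    and m: "\<And>j. j \<in> J \<Longrightarrow> 0 \<le> m j" "\<And>j. j \<in> J \<Longrightarrow> m j = 0 \<Longrightarrow> tr (a * q j) = 0"
  shows "entropy 1 a \<le> (\<Sum>j\<in>J. - tr (a * q j) * ln (m j)) + (\<Sum>j\<in>J. m j * tr (q j)) - tr a"
proof -
  obtain L p where L: "orthogonal_projections L p" "\<And>l. l \<in> L \<Longrightarrow> l \<ge> 0"
    "(\<Sum>l\<in>L. p l) = 1" "a = (\<Sum>l\<in>L. l *\<^sub>R p l)"
    using spectral_theorem_positive_one[OF a] by metis
  have fin: "finite L" using L(1) by (simp add: orthogonal_projections_def)
  \<comment> \<open>A nonnegative coupling of the two spectra with marginals \<open>tr (p l)\<close>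
    and \<open>tr (q j)\<close>. It reduces the noncommutative inequality to the scalar tangent of
    \<open>eta\<close> at \<open>m j\<close>, pair by pair.\<close>
  define w where "w l j = tr (p l * q j)" for l j
  have w0: "0 \<le> w l j" if "l \<in> L" "j \<in> J" for l j
    unfolding w_def using L(1) q(1) that
    by (intro tr_mult_projection_nonneg projection_positive) (auto simp: orthogonal_projections_def)
  have wJ: "(\<Sum>j\<in>J. w l j) = tr (p l)" for l
    by (simp add: w_def q(2) flip: tr_sum sum_distrib_left)
  have wL: "(\<Sum>l\<in>L. w l j) = tr (q j)" for j
    by (simp add: w_def L(3) flip: tr_sum sum_distrib_right)
  have wa: "(\<Sum>l\<in>L. l * w l j) = tr (a * q j)" for j
    by (simp add: w_def L(4) sum_distrib_right tr_sum flip: tr_scaleR)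
  have le: "eta l * w l j \<le> (- l * ln (m j) + m j - l) * w l j" if "l \<in> L" "j \<in> J" for l j
  proof (cases "m j = 0")
    case True
    have "(\<Sum>l\<in>L. l * w l j) = 0" using wa m(2)[OF that(2) True] by simp
    then have "l * w l j = 0"
      using that fin L(2) w0 sum_nonneg_eq_0_iff[of L "\<lambda>l. l * w l j"] by auto
    then show ?thesis using True by auto
  next
    case False
    then show ?thesis
      using eta_le_tangent[of l "m j"] L(2)[OF that(1)] m(1)[OF that(2)] w0[OF that]
      by (intro mult_right_mono) auto
  qed
  have "entropy 1 a = (\<Sum>l\<in>L. \<Sum>j\<in>J. eta l * w l j)"
    unfolding L(4) entropy_sum_one[OF L(1)] by (simp add: wJ flip: sum_distrib_left)
  also have "\<dots> \<le> (\<Sum>l\<in>L. \<Sum>j\<in>J. (- l * ln (m j) + m j - l) * w l j)"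
    using le by (intro sum_mono) auto
  also have "\<dots> = (\<Sum>j\<in>J. \<Sum>l\<in>L. - ln (m j) * (l * w l j) + m j * w l j - l * w l j)"
    by (subst sum.swap) (simp add: algebra_simps)
  also have "\<dots> = (\<Sum>j\<in>J. - ln (m j) * tr (a * q j) + m j * tr (q j) - tr (a * q j))"
    by (simp only: sum.distrib sum_subtractf wa wL flip: sum_distrib_left)
  also have "\<dots> = (\<Sum>j\<in>J. - tr (a * q j) * ln (m j) + m j * tr (q j) - tr (a * q j))"
    by (simp add: mult.commute)
  also have "\<dots> = (\<Sum>j\<in>J. - tr (a * q j) * ln (m j)) + (\<Sum>j\<in>J. m j * tr (q j)) - tr a"
    by (simp only: sum.distrib sum_subtractf q(2) mult_1_right flip: tr_sum sum_distrib_left)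
  finally show ?thesis .
qed

text \<open>The Gibbs inequality against the eigendecomposition of the pinched operator. That
  operator and \<open>b\<close> have the same trace against each of its eigenprojections
  \<open>p i l\<close>, so the bound is its own entropy.\<close>

lemma entropy_le_pinching:
  fixes b :: "'a::fd_cstar_algebra"
  assumes b: "positive b" and f: "orthogonal_projections I f" "(\<Sum>i\<in>I. f i) = 1"
  shows "entropy 1 b \<le> (\<Sum>i\<in>I. entropy 1 (f i * b * f i))"
proof -
  have fin: "finite I" using f(1) by (simp add: orthogonal_projections_def)
  have proj: "projection (f i)" if "i \<in> I" for i using f(1) that by (simp add: orthogonal_projections_def)
  define Q where "Q i L p \<longleftrightarrow> orthogonal_projections L p \<and> (\<forall>l\<in>L. p l \<in> corner (f i)) \<and>
      (\<forall>l\<in>L. l \<ge> 0) \<and> (\<Sum>l\<in>L. p l) = f i \<and> f i * b * f i = (\<Sum>l\<in>L. l *\<^sub>R p l)" for i L p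
  have "\<exists>L p. Q i L p" if "i \<in> I" for i
    unfolding Q_def
    using spectral_theorem_positive[OF positive_compress_projection[OF b proj[OF that]] proj[OF that] corner_compress]
    by metis
  then obtain L p where "\<And>i. i \<in> I \<Longrightarrow> Q i (L i) (p i)" by metis
  then have L: "\<And>i. i \<in> I \<Longrightarrow> orthogonal_projections (L i) (p i)"
    "\<And>i l. i \<in> I \<Longrightarrow> l \<in> L i \<Longrightarrow> p i l \<in> corner (f i)"
    "\<And>i l. i \<in> I \<Longrightarrow> l \<in> L i \<Longrightarrow> l \<ge> 0"
    "\<And>i. i \<in> I \<Longrightarrow> (\<Sum>l\<in>L i. p i l) = f i"
    "\<And>i. i \<in> I \<Longrightarrow> f i * b * f i = (\<Sum>l\<in>L i. l *\<^sub>R p i l)"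
    unfolding Q_def by blast+
  have finL: "\<forall>i\<in>I. finite (L i)" using L(1) by (simp add: orthogonal_projections_def)
  have trb: "tr (b * p i l) = l * tr (p i l)" if "i \<in> I" "l \<in> L i" for i l
  proof -
    have "p i l = f i * (p i l * f i)"
      using L(2)[OF that] by (simp add: corner_iff[OF proj[OF that(1)]])
    then have "tr (b * p i l) = tr ((b * f i * p i l) * f i)" by (metis mult.assoc)
    also have "\<dots> = tr (f i * b * f i * p i l)" by (subst tr_mult_commute) (simp add: mult.assoc)
    also have "f i * b * f i * p i l = l *\<^sub>R p i l"
      unfolding L(5)[OF that(1)] by (rule sum_mult_orthogonal_projections[OF L(1)[OF that(1)] that(2)])
    finally show ?thesis by (simp add: tr_scaleR)
  qed
  have "(\<Sum>x\<in>Sigma I L. case x of (i, l) \<Rightarrow> p i l) = 1"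
    using L(4) f(2) by (simp add: sum.Sigma[OF fin finL, symmetric])
  then have "entropy 1 b \<le> (\<Sum>x\<in>Sigma I L. - tr (b * (case x of (i, l) \<Rightarrow> p i l)) * ln (snd x)) +
      (\<Sum>x\<in>Sigma I L. snd x * tr (case x of (i, l) \<Rightarrow> p i l)) - tr b"
    using L(3) trb
    by (intro gibbs_inequality[OF b orthogonal_projections_Sigma[OF f(1) L(1,2)]]) auto
  also have "\<dots> = (\<Sum>i\<in>I. \<Sum>l\<in>L i. - tr (b * p i l) * ln l) + (\<Sum>i\<in>I. \<Sum>l\<in>L i. l * tr (p i l)) - tr b"
    by (simp add: sum.Sigma[OF fin finL] split_def)
  also have "(\<Sum>i\<in>I. \<Sum>l\<in>L i. l * tr (p i l)) = (\<Sum>i\<in>I. \<Sum>l\<in>L i. tr (b * p i l))"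
    using trb by simp
  also have "\<dots> = tr b" using L(4) f(2) by (simp flip: tr_sum sum_distrib_left)
  also have "(\<Sum>i\<in>I. \<Sum>l\<in>L i. - tr (b * p i l) * ln l) = (\<Sum>i\<in>I. entropy 1 (f i * b * f i))"
  proof (rule sum.cong)
    fix i assume i: "i \<in> I"
    show "(\<Sum>l\<in>L i. - tr (b * p i l) * ln l) = entropy 1 (f i * b * f i)"
      unfolding L(5)[OF i] entropy_sum_one[OF L(1)[OF i]]
      using trb[OF i] L(3)[OF i] by (intro sum.cong) (fastforce simp: eta_def)+
  qed simp
  finally show ?thesis by simp
qed

text \<open>For \<open>l > 0\<close>, passing from \<open>p l\<close> to
  \<open>x * p l * star x\<close> divided by \<open>l\<close> carries eigenprojections of
  \<open>star x * x\<close> to those of \<open>x * star x\<close> with equal trace; the eigenvalue 0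
  carries no entropy.\<close>

lemma entropy_star_mult_commute:
  fixes x :: "'a::fd_cstar_algebra"
  shows "entropy 1 (star x * x) = entropy 1 (x * star x)"
proof -
  have pos: "positive (star x * x)" by (auto simp: positive_def)
  obtain L p where L: "orthogonal_projections L p" "\<And>l. l \<in> L \<Longrightarrow> l \<ge> 0"
    "(\<Sum>l\<in>L. p l) = 1" "star x * x = (\<Sum>l\<in>L. l *\<^sub>R p l)"
    using spectral_theorem_positive_one[OF pos] by metis
  have fin: "finite L" using L(1) by (simp add: orthogonal_projections_def)
  have proj: "projection (p l)" if "l \<in> L" for l using L(1) that by (simp add: orthogonal_projections_def)
  define K where "K = {l\<in>L. l > 0}"
  define r where "r l = (1 / l) *\<^sub>R (x * p l * star x)" for l
  have xp: "p l * (star x * (x * p m)) = (if l = m then m *\<^sub>R p m else 0)" if "l \<in> L" "m \<in> L" for l m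
  proof -
    have "p l * (star x * x * p m) = m *\<^sub>R (p l * p m)"
      unfolding L(4) by (simp add: sum_mult_orthogonal_projections[OF L(1) that(2)])
    then show ?thesis using orthogonal_projections_mult[OF L(1) that] by (simp add: mult.assoc)
  qed
  have "r l * r m = (if l = m then r l else 0)" if "l \<in> K" "m \<in> K" for l m
  proof -
    have "r l * r m = (1 / l) *\<^sub>R (1 / m) *\<^sub>R (x * (p l * (star x * (x * p m))) * star x)"
      by (simp add: r_def mult.assoc)
    then show ?thesis using xp[of l m] that by (auto simp: K_def r_def)
  qed
  moreover have "star (r l) = r l" if "l \<in> K" for l
    using proj that by (simp add: r_def star_scaleR star_mult projection_star K_def mult.assoc)
  ultimately have r: "orthogonal_projections K r"
    using fin by (auto simp: orthogonal_projections_def projection_def K_def)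
  \<comment> \<open>The kernel of \<open>star x * x\<close> is killed by \<open>x\<close>, so
    keeping only positive eigenvalues loses nothing of \<open>x * star x\<close>.\<close>
  have "x * p 0 = 0" if "0 \<in> L"
  proof -
    have "star (x * p 0) * (x * p 0) = 0"
      using xp[OF that that] proj[OF that] by (simp add: star_mult projection_star mult.assoc)
    then show ?thesis by simp
  qed
  then have x0: "x * p l * star x = 0" if "l \<in> L - K" for l
    using that L(2)[of l] by (cases "l = 0") (auto simp: K_def)
  have "(\<Sum>l\<in>K. l *\<^sub>R r l) = (\<Sum>l\<in>K. x * p l * star x)"
    by (rule sum.cong) (auto simp: r_def K_def)
  also have "\<dots> = (\<Sum>l\<in>L. x * p l * star x)"
    by (rule sum.mono_neutral_left) (use fin x0 in \<open>auto simp: K_def\<close>)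
  also have "\<dots> = x * star x" by (simp add: L(3) flip: sum_distrib_left sum_distrib_right)
  finally have "entropy 1 (x * star x) = (\<Sum>l\<in>K. eta l * tr (r l))"
    using entropy_sum_one[OF r, of "\<lambda>l. l"] by simp
  also have "\<dots> = (\<Sum>l\<in>K. eta l * tr (p l))"
  proof (rule sum.cong)
    fix l assume l: "l \<in> K"
    have "tr (x * p l * star x) = tr (star x * x * p l)"
      by (subst tr_mult_commute) (simp add: mult.assoc)
    also have "star x * x * p l = l *\<^sub>R p l"
      unfolding L(4) using l by (intro sum_mult_orthogonal_projections[OF L(1)]) (simp add: K_def)
    finally show "eta l * tr (r l) = eta l * tr (p l)"
      using l by (simp add: r_def tr_scaleR K_def)
  qed simp
  also have "\<dots> = (\<Sum>l\<in>L. eta l * tr (p l))"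
    by (rule sum.mono_neutral_left) (use fin in \<open>auto simp: K_def eta_def\<close>)
  also have "\<dots> = entropy 1 (star x * x)" unfolding L(4) by (rule entropy_sum_one[OF L(1), symmetric])
  finally show ?thesis by simp
qed

text \<open>\<open>tr a\<close> times the entropy of \<open>a / tr a\<close>, as a positively homogeneous functional.\<close>

definition hom_entropy :: "'a::cstar_algebra \<Rightarrow> real" where
  "hom_entropy a = entropy 1 a - eta (tr a)"

lemma hom_entropy_0 [simp]: "hom_entropy (0::'a::fd_cstar_algebra) = 0"
  by (simp add: hom_entropy_def)

lemma hom_entropy_tr_1: "tr a = 1 \<Longrightarrow> hom_entropy a = entropy 1 a"
  by (simp add: hom_entropy_def)

lemma hom_entropy_scaleR:
  fixes a :: "'a::fd_cstar_algebra"
  assumes "positive a" "0 \<le> w"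
  shows "hom_entropy (w *\<^sub>R a) = w * hom_entropy a"
  using entropy_scaleR[OF assms] tr_nonneg[OF assms(1)] assms(2)
  by (simp add: hom_entropy_def tr_scaleR eta_mult algebra_simps)

text \<open>Concavity of the entropy in homogeneous form. Each \<open>b k\<close> is compared, by
  the Gibbs inequality, with the total \<open>c\<close> rescaled; the resulting bounds are linear in
  \<open>b k\<close> and add up to the value at \<open>c\<close>.\<close>

lemma hom_entropy_superadditive:
  fixes b :: "'k \<Rightarrow> 'a::fd_cstar_algebra"
  assumes fin: "finite K" and b: "\<And>k. k \<in> K \<Longrightarrow> positive (b k)"
  shows "(\<Sum>k\<in>K. hom_entropy (b k)) \<le> hom_entropy (\<Sum>k\<in>K. b k)"
proof -
  define c where "c = (\<Sum>k\<in>K. b k)"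
  have "positive c" using b by (auto simp: c_def intro: positive_sum)
  obtain L p where L: "orthogonal_projections L p" "\<And>l. l \<in> L \<Longrightarrow> l \<ge> 0"
    "(\<Sum>l\<in>L. p l) = 1" "c = (\<Sum>l\<in>L. l *\<^sub>R p l)"
    using spectral_theorem_positive_one[OF \<open>positive c\<close>] by metis
  have proj: "projection (p l)" if "l \<in> L" for l using L(1) that by (simp add: orthogonal_projections_def)
  have cp: "tr (c * p l) = l * tr (p l)" if "l \<in> L" for l
    unfolding L(4) by (simp add: sum_mult_orthogonal_projections[OF L(1) that] tr_scaleR)
  have tc: "(\<Sum>l\<in>L. l * tr (p l)) = tr c" by (simp add: L(4) tr_sum tr_scaleR)
  have sumb: "(\<Sum>k\<in>K. tr (b k * x)) = tr (c * x)" for x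
    by (simp add: c_def sum_distrib_right tr_sum)
  have le: "hom_entropy (b k) \<le> (\<Sum>l\<in>L. - tr (b k * p l) * ln l) + tr (b k) * ln (tr c)" if k: "k \<in> K" for k
  proof (cases "tr (b k) = 0")
    case True
    then have "b k = 0" using tr_eq_0 b[OF k] by blast
    then show ?thesis by simp
  next
    case False
    then have t: "tr (b k) > 0" using tr_nonneg[OF b[OF k]] by simp
    also have "tr (b k) \<le> (\<Sum>k\<in>K. tr (b k))"
      using k fin b tr_nonneg by (intro member_le_sum) auto
    finally have T: "tr c > 0" by (simp add: c_def tr_sum)
    \<comment> \<open>Rescaling \<open>c\<close> by \<open>r\<close> gives it the trace of
      \<open>b k\<close>, so that the two trace terms of the Gibbs bound cancel.\<close>
    define r where "r = tr (b k) / tr c"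
    have r: "r > 0" using t T by (simp add: r_def)
    \<comment> \<open>The support condition: on the kernel of \<open>c\<close> the nonnegative
      numbers \<open>tr (b k * p l)\<close> sum to 0 over \<open>k\<close>.\<close>
    have b0: "tr (b k * p l) = 0" if "l \<in> L" "l = 0" for l
    proof -
      have "tr (b k * p l) \<le> (\<Sum>k\<in>K. tr (b k * p l))"
        using k fin b tr_mult_projection_nonneg proj[OF that(1)] by (intro member_le_sum) auto
      also have "\<dots> = 0" using sumb[of "p l"] cp[OF that(1)] that(2) by simp
      finally show ?thesis using tr_mult_projection_nonneg[OF b[OF k] proj[OF that(1)]] by simp
    qed
    have "entropy 1 (b k) \<le> (\<Sum>l\<in>L. - tr (b k * p l) * ln (l * r)) + (\<Sum>l\<in>L. l * r * tr (p l)) - tr (b k)"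
      using L(2) r b0 by (intro gibbs_inequality[OF b[OF k] L(1,3)]) auto
    also have "(\<Sum>l\<in>L. l * r * tr (p l)) = r * (\<Sum>l\<in>L. l * tr (p l))"
      by (simp add: sum_distrib_left ac_simps)
    also have "\<dots> = tr (b k)" using T by (simp add: tc r_def)
    also have "(\<Sum>l\<in>L. - tr (b k * p l) * ln (l * r)) =
        (\<Sum>l\<in>L. - tr (b k * p l) * ln l - ln r * tr (b k * p l))"
    proof (rule sum.cong)
      fix l assume l: "l \<in> L"
      show "- tr (b k * p l) * ln (l * r) = - tr (b k * p l) * ln l - ln r * tr (b k * p l)"
      proof (cases "l = 0")
        case False
        then have "ln (l * r) = ln l + ln r" using L(2)[OF l] r by (simp add: ln_mult)
        then show ?thesis by (simp add: algebra_simps)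
      qed (use b0[OF l] in simp)
    qed simp
    also have "\<dots> = (\<Sum>l\<in>L. - tr (b k * p l) * ln l) - ln r * tr (b k)"
      by (simp only: sum_subtractf L(3) mult_1_right flip: sum_distrib_left tr_sum)
    also have "ln r = ln (tr (b k)) - ln (tr c)" using t T by (simp add: r_def ln_div)
    finally show ?thesis using t by (simp add: hom_entropy_def eta_def algebra_simps)
  qed
  have "(\<Sum>k\<in>K. hom_entropy (b k)) \<le> (\<Sum>k\<in>K. (\<Sum>l\<in>L. - tr (b k * p l) * ln l) + tr (b k) * ln (tr c))"
    using le by (rule sum_mono)
  also have "\<dots> = (\<Sum>l\<in>L. - (\<Sum>k\<in>K. tr (b k * p l)) * ln l) + (\<Sum>k\<in>K. tr (b k * 1)) * ln (tr c)"
    unfolding sum.distrib by (subst sum.swap) (simp add: sum_distrib_right sum_negf)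
  also have "\<dots> = (\<Sum>l\<in>L. - (l * tr (p l)) * ln l) + tr c * ln (tr c)"
    unfolding sumb using cp by simp
  also have "(\<Sum>l\<in>L. - (l * tr (p l)) * ln l) = entropy 1 c"
    unfolding L(4) entropy_sum_one[OF L(1)] using L(2) by (intro sum.cong) (fastforce simp: eta_def)+
  also have "tr c * ln (tr c) = - eta (tr c)"
    using tr_nonneg[OF \<open>positive c\<close>] by (auto simp: eta_def)
  finally show ?thesis by (simp add: hom_entropy_def c_def)
qed

text \<open>With \<open>b = star y * y\<close>, the compression \<open>f i * b * f i\<close> has the same spectrum as
  \<open>y * f i * star y\<close>, and the latter sum up to \<open>y * star y\<close>.\<close>

lemma sum_hom_entropy_compress_le:
  fixes b :: "'a::fd_cstar_algebra"
  assumes b: "positive b" and f: "orthogonal_projections I f" "(\<Sum>i\<in>I. f i) = 1"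
  shows "(\<Sum>i\<in>I. hom_entropy (f i * b * f i)) \<le> hom_entropy b"
proof -
  have fin: "finite I" using f(1) by (simp add: orthogonal_projections_def)
  have proj: "projection (f i)" if "i \<in> I" for i using f(1) that by (simp add: orthogonal_projections_def)
  obtain y where y: "b = star y * y" using b by (auto simp: positive_def)
  have swap: "hom_entropy (star x * x) = hom_entropy (x * star x)" for x :: 'a
    by (simp add: hom_entropy_def entropy_star_mult_commute tr_mult_commute[of "star x"])
  have i: "hom_entropy (f i * b * f i) = hom_entropy (y * f i * star y)" "positive (y * f i * star y)"
    if "i \<in> I" for i
  proof -
    have "f i * b * f i = star (y * f i) * (y * f i)" "y * f i * star y = (y * f i) * star (y * f i)"
      using proj[OF that] by (simp_all add: y star_mult projection_star mult.assoc projection_idem_left)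
    then show "hom_entropy (f i * b * f i) = hom_entropy (y * f i * star y)" using swap by simp
    show "positive (y * f i * star y)"
      using positive_compress[OF projection_positive[OF proj[OF that]], of "star y"] by simp
  qed
  have "(\<Sum>i\<in>I. hom_entropy (f i * b * f i)) \<le> hom_entropy (\<Sum>i\<in>I. y * f i * star y)"
    using hom_entropy_superadditive[OF fin i(2)] i(1) by simp
  also have "(\<Sum>i\<in>I. y * f i * star y) = y * star y"
    by (simp add: f(2) flip: sum_distrib_left sum_distrib_right)
  finally show ?thesis by (simp add: y swap)
qed

subsection \<open>Positive unital trace preserving maps\<close>

text \<open>With \<open>a = star w * w\<close> the compression is
  \<open>star (w * g) * (w * g)\<close>, so already \<open>w * g = 0\<close>.\<close>

lemma positive_compress_eq_0:
  fixes a :: "'a::cstar_algebra"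
  assumes "positive a" "projection g" "g * a * g = 0"
  shows "a * g = 0" "g * a = 0"
proof -
  obtain w where w: "a = star w * w" using assms(1) by (auto simp: positive_def)
  have "star (w * g) * (w * g) = 0"
    using assms(2,3) by (simp add: w star_mult projection_star mult.assoc)
  then have "w * g = 0" by simp
  then show "a * g = 0" by (simp add: w mult.assoc)
  then have "star (a * g) = 0" by simp
  then show "g * a = 0" using assms(1,2) by (simp add: star_mult positive_star projection_star)
qed

lemma linear_coeff_eq_0_if_quadratic_nonneg:
  fixes \<alpha> \<beta> :: real
  assumes "\<And>t. 0 \<le> \<alpha> * t + \<beta> * t\<^sup>2"
  shows "\<alpha> = 0"
proof (rule ccontr)
  assume "\<alpha> \<noteq> 0"
  \<comment> \<open>Small enough, through \<open>\<beta> * s < 1\<close>, for the linear term to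
    dominate at \<open>- \<alpha> * s\<close>.\<close>
  define s where "s = 1 / (1 + \<bar>\<beta>\<bar>)"
  have s: "s > 0" "\<beta> * s < 1" by (auto simp: s_def field_simps)
  have "\<alpha> * (- \<alpha> * s) + \<beta> * (- \<alpha> * s)\<^sup>2 = \<alpha>\<^sup>2 * s * (\<beta> * s - 1)"
    by (simp add: power2_eq_square algebra_simps)
  also have "\<dots> < 0" using \<open>\<alpha> \<noteq> 0\<close> s by (intro mult_pos_neg) auto
  finally show False using assms[of "- \<alpha> * s"] by simp
qed

locale positive_trace_preserving =
  fixes \<Phi> :: "'m::fd_cstar_algebra \<Rightarrow> 'p::fd_cstar_algebra"
  assumes linear: "Vector_Spaces.linear scaleC scaleC \<Phi>"
    and positive: "positive x \<Longrightarrow> positive (\<Phi> x)"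
    and unital: "\<Phi> 1 = 1"
    and trace_preserving: "Tr 1 (\<Phi> x) = Tr 1 x"
begin

lemma map_add: "\<Phi> (x + y) = \<Phi> x + \<Phi> y"
  using linear by (simp add: Vector_Spaces.linear_def module_hom_iff)

lemma map_scaleR: "\<Phi> (r *\<^sub>R x) = r *\<^sub>R \<Phi> x"
  using linear by (simp add: scaleR_scaleC Vector_Spaces.linear_def module_hom_iff)

lemma map_0 [simp]: "\<Phi> 0 = 0"
  using map_scaleR[of 0 0] by simp

lemma map_diff: "\<Phi> (x - y) = \<Phi> x - \<Phi> y"
  using map_add[of x "(-1) *\<^sub>R y"] map_scaleR[of "-1" y] by simp

lemma map_sum: "\<Phi> (\<Sum>i\<in>I. h i) = (\<Sum>i\<in>I. \<Phi> (h i))"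
  by (induction I rule: infinite_finite_induct) (simp_all add: map_add)

lemma tr_map: "tr (\<Phi> x) = tr x"
  by (simp add: tr_def trace_preserving)

text \<open>If \<open>c\<close> bounds the eigenvalues of \<open>x\<close>, positivity puts
  \<open>\<Phi> x\<close> between 0 and \<open>c\<close> times \<open>\<Phi> e\<close>. Its
  compression by \<open>1 - \<Phi> e\<close> is then 0, and with it both off-diagonal parts.\<close>

lemma map_corner:
  assumes e: "projection e" "projection (\<Phi> e)" and x: "positive x" "x \<in> corner e"
  shows "\<Phi> x \<in> corner (\<Phi> e)"
proof -
  obtain L p where L: "orthogonal_projections L p" "\<And>l. l \<in> L \<Longrightarrow> p l \<in> corner e"
    "\<And>l. l \<in> L \<Longrightarrow> l \<ge> 0" "(\<Sum>l\<in>L. p l) = e" "x = (\<Sum>l\<in>L. l *\<^sub>R p l)"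
    using spectral_theorem_positive[OF x(1) e(1) x(2)] by metis
  have fin: "finite L" using L(1) by (simp add: orthogonal_projections_def)
  define c where "c = \<Sum>L"
  have "l \<le> c" if "l \<in> L" for l
    unfolding c_def using that fin L(3) by (intro member_le_sum[where f="\<lambda>l. l"]) auto
  then have "positive (\<Sum>l\<in>L. (c - l) *\<^sub>R p l)" by (intro positive_in_sum[OF L(1)]) auto
  also have "(\<Sum>l\<in>L. (c - l) *\<^sub>R p l) = c *\<^sub>R e - x"
    unfolding L(5) L(4)[symmetric] by (simp add: scaleR_diff_left sum_subtractf scaleR_sum_right)
  finally have z: "positive (\<Phi> (c *\<^sub>R e - x))" by (rule positive)
  define g where "g = 1 - \<Phi> e"
  have g: "projection g" unfolding g_def by (rule projection_diff) (use e in auto)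
  have fg: "\<Phi> e * g = 0" using e(2) by (simp add: g_def right_diff_distrib projection_idem)
  have "g * \<Phi> (c *\<^sub>R e - x) * g = - (g * \<Phi> x * g)"
    using fg by (simp add: map_diff map_scaleR right_diff_distrib left_diff_distrib mult.assoc)
  then have "tr (g * \<Phi> x * g) \<le> 0"
    using tr_nonneg[OF positive_compress_projection[OF z g]] tr_scaleR[of "-1" "g * \<Phi> x * g"] by simp
  then have "tr (g * \<Phi> x * g) = 0"
    using tr_nonneg[OF positive_compress_projection[OF positive[OF x(1)] g]] by simp
  then have "g * \<Phi> x * g = 0"
    using tr_eq_0 positive_compress_projection[OF positive[OF x(1)] g] by blast
  from positive_compress_eq_0[OF positive[OF x(1)] g this] show ?thesis
    by (simp add: corner_iff[OF e(2)] g_def left_diff_distrib right_diff_distrib)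
qed

lemma projection_complement:
  assumes "projection e" "projection (\<Phi> e)"
  shows "projection (1 - e)" "projection (\<Phi> (1 - e))"
  using assms by (simp_all add: projection_diff map_diff unital)

text \<open>The element \<open>(e + t (1 - e)) x (e + t (1 - e))\<close> is positive for every real \<open>t\<close>; compressed by
  \<open>1 - \<Phi>(e)\<close>, its image has no constant term in \<open>t\<close>, so the linear term vanishes too.\<close>

lemma map_off_diagonal:
  assumes e: "projection e" "projection (\<Phi> e)" and x: "positive x"
  shows "(1 - \<Phi> e) * \<Phi> (e * x * (1 - e) + (1 - e) * x * e) * (1 - \<Phi> e) = 0"
proof -
  define g where "g = 1 - e"
  define h where "h = 1 - \<Phi> e"
  define u where "u = h * \<Phi> (e * x * g + g * x * e) * h"
  define d where "d = h * \<Phi> (g * x * g) * h"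
  have g: "projection g" and h: "projection h"
    using projection_complement[OF e] by (simp_all add: g_def h_def map_diff unital)
  have "\<Phi> (e * x * e) \<in> corner (\<Phi> e)"
    by (intro map_corner e positive_compress_projection x corner_compress)
  then have "\<Phi> (e * x * e) * h = 0"
    by (simp add: h_def corner_iff[OF e(2)] right_diff_distrib)
  then have diag: "h * \<Phi> (e * x * e) * h = 0" by (simp add: mult.assoc)
  have pos: "positive (t *\<^sub>R u + (t\<^sup>2) *\<^sub>R d)" for t
  proof -
    have "star (e + t *\<^sub>R g) = e + t *\<^sub>R g"
      using e(1) g by (simp add: star_add star_scaleR projection_star)
    then have "positive ((e + t *\<^sub>R g) * x * (e + t *\<^sub>R g))"
      using positive_compress[OF x, of "e + t *\<^sub>R g"] by simp
    also have "(e + t *\<^sub>R g) * x * (e + t *\<^sub>R g) =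
        e * x * e + (t *\<^sub>R (e * x * g + g * x * e) + t\<^sup>2 *\<^sub>R (g * x * g))"
      by (simp add: distrib_left distrib_right power2_eq_square scaleR_add_right)
    finally have "positive (h * \<Phi> (e * x * e + (t *\<^sub>R (e * x * g + g * x * e) + t\<^sup>2 *\<^sub>R (g * x * g))) * h)"
      by (intro positive_compress_projection positive h)
    also have "h * \<Phi> (e * x * e + (t *\<^sub>R (e * x * g + g * x * e) + t\<^sup>2 *\<^sub>R (g * x * g))) * h =
        h * \<Phi> (e * x * e) * h + (t *\<^sub>R u + t\<^sup>2 *\<^sub>R d)"
      unfolding u_def d_def map_add[of "e * x * e"]
      unfolding map_add[of "t *\<^sub>R (e * x * g + g * x * e)"] map_scaleR
      by (simp only: distrib_left distrib_right mult_scaleR_left mult_scaleR_right)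
    finally show ?thesis using diag by simp
  qed
  have "positive d"
    unfolding d_def by (intro positive_compress_projection positive x g h)
  then have "star u = u"
    using positive_star[OF pos[of 1]] positive_star[of d] by (simp add: star_add)
  moreover have "tr (u * q) = 0" if "projection q" for q
  proof (rule linear_coeff_eq_0_if_quadratic_nonneg)
    show "0 \<le> tr (u * q) * t + tr (d * q) * t\<^sup>2" for t
      using tr_mult_projection_nonneg[OF pos that, of t]
      by (simp add: distrib_right tr_add tr_scaleR mult.commute)
  qed
  ultimately have "u = 0" by (rule eq_0_if_tr_mult_projection_eq_0)
  then show ?thesis by (simp add: u_def g_def h_def)
qed

text \<open>Splits \<open>x\<close> into four blocks along \<open>e\<close> and
  \<open>g = 1 - e\<close>. The images of the diagonal blocks stay in the corners of
  \<open>\<Phi> e\<close> and \<open>\<Phi> g\<close>; the image of the off-diagonal part vanishes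
  under compression by \<open>\<Phi> e\<close>.\<close>

lemma map_compress:
  assumes e: "projection e" "projection (\<Phi> e)" and x: "positive x"
  shows "\<Phi> (e * x * e) = \<Phi> e * \<Phi> x * \<Phi> e"
proof -
  define g where "g = 1 - e"
  note g = projection_complement[OF e, folded g_def]
  have fg: "\<Phi> g = 1 - \<Phi> e" by (simp add: g_def map_diff unital)
  \<comment> \<open>Applied to the complement, since \<open>1 - \<Phi> g = \<Phi> e\<close> is the
    compression wanted here.\<close>
  have "(1 - \<Phi> g) * \<Phi> (g * x * (1 - g) + (1 - g) * x * g) * (1 - \<Phi> g) = 0"
    by (rule map_off_diagonal[OF g x])
  then have off: "\<Phi> e * \<Phi> (e * x * g + g * x * e) * \<Phi> e = 0"
    unfolding fg by (simp add: g_def add.commute)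
  have "\<Phi> (e * x * e) \<in> corner (\<Phi> e)"
    by (intro map_corner e positive_compress_projection x corner_compress)
  then have diag: "\<Phi> e * \<Phi> (e * x * e) * \<Phi> e = \<Phi> (e * x * e)" by (simp add: corner_iff[OF e(2)])
  have "\<Phi> (g * x * g) \<in> corner (\<Phi> g)"
    by (intro map_corner g positive_compress_projection x corner_compress)
  then have "\<Phi> e * \<Phi> (g * x * g) = 0"
    using corner_iff[OF g(2)] by (simp add: fg left_diff_distrib)
  then have diag': "\<Phi> e * \<Phi> (g * x * g) * \<Phi> e = 0" by simp
  have "x = e * x * e + ((e * x * g + g * x * e) + g * x * g)"
    by (simp add: g_def algebra_simps)
  then have "\<Phi> x = \<Phi> (e * x * e) + (\<Phi> (e * x * g + g * x * e) + \<Phi> (g * x * g))"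
    by (metis map_add)
  then have "\<Phi> e * \<Phi> x * \<Phi> e = \<Phi> e * \<Phi> (e * x * e) * \<Phi> e +
      (\<Phi> e * \<Phi> (e * x * g + g * x * e) * \<Phi> e + \<Phi> e * \<Phi> (g * x * g) * \<Phi> e)"
    by (simp only: distrib_left distrib_right)
  then show ?thesis using off diag diag' by simp
qed

subsection \<open>Capacity\<close>

text \<open>A convex combination \<open>\<Sum>k. l k *\<^sub>R a k\<close> of states is encoded by the family \<open>y k = l k *\<^sub>R a k\<close>.\<close>

definition ensemble :: "'m \<Rightarrow> 'k set \<Rightarrow> ('k \<Rightarrow> 'm) \<Rightarrow> bool" where
  "ensemble e A y \<longleftrightarrow> finite A \<and> (\<forall>k\<in>A. positive (y k) \<and> y k \<in> corner e) \<and> (\<Sum>k\<in>A. tr (y k)) = 1"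

text \<open>The Holevo quantity of the ensemble, with the weights absorbed by homogeneity; it also
  makes sense for total trace other than 1, as for the blocks \<open>e i * y k * e i\<close>. The
  free index type admits \<open>Sigma\<close> sets for mixtures.\<close>

definition holevo :: "'k set \<Rightarrow> ('k \<Rightarrow> 'm) \<Rightarrow> real" where
  "holevo A y = hom_entropy (\<Phi> (\<Sum>k\<in>A. y k)) - (\<Sum>k\<in>A. hom_entropy (\<Phi> (y k)))"

abbreviation corner_capacity :: "'m \<Rightarrow> ereal" where
  "corner_capacity e \<equiv> capacity e (\<Phi> e) (restrict \<Phi> (corner e))"

lemma ensembleD:
  assumes "ensemble e A y"
  shows "finite A" "\<And>k. k \<in> A \<Longrightarrow> positive (y k)" "\<And>k. k \<in> A \<Longrightarrow> y k \<in> corner e"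
    "(\<Sum>k\<in>A. tr (y k)) = 1"
  using assms by (auto simp: ensemble_def)

lemma ensemble_sum_states:
  assumes "projection e" "ensemble e A y"
  shows "(\<Sum>k\<in>A. y k) \<in> states e"
  using ensembleD[OF assms(2)] by (auto simp: states_iff[OF assms(1)] tr_sum intro: positive_sum corner_sum)

lemma entropy_map_state:
  assumes e: "projection e" "projection (\<Phi> e)" and x: "x \<in> states e"
  shows "entropy (\<Phi> e) (restrict \<Phi> (corner e) x) = hom_entropy (\<Phi> x)"
proof -
  have x': "positive x" "x \<in> corner e" "tr x = 1" using x by (simp_all add: states_iff[OF e(1)])
  have "entropy (\<Phi> e) (\<Phi> x) = entropy 1 (\<Phi> x)"
    by (intro entropy_corner e positive_star positive map_corner x')
  then show ?thesis using x' by (simp add: hom_entropy_tr_1 tr_map)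
qed

lemma holevo_le_capacity:
  fixes A :: "'k set"
  assumes e: "projection e" "projection (\<Phi> e)" and y: "ensemble e A y"
  shows "ereal (holevo A y) \<le> corner_capacity e"
proof -
  note y' = ensembleD[OF y]
  define a where "a = (\<Sum>k\<in>A. y k)"
  have a: "a \<in> states e" unfolding a_def by (rule ensemble_sum_states[OF e(1) y])
  obtain h where h: "bij_betw h {..<card A} A"
    using ex_bij_betw_nat_finite[OF y'(1)] by (auto simp: atLeast0LessThan)
  define l where "l i = tr (y (h i))" for i
  define x where "x i = (if l i = 0 then a else (1 / l i) *\<^sub>R y (h i))" for i
  have hA: "h i \<in> A" if "i < card A" for i using h that by (auto simp: bij_betw_def)
  have l: "0 \<le> l i" if "i < card A" for i unfolding l_def by (rule tr_nonneg[OF y'(2)[OF hA[OF that]]])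
  have lx: "l i *\<^sub>R x i = y (h i)" if "i < card A" for i
    using tr_eq_0[OF y'(2)[OF hA[OF that]]] by (auto simp: x_def l_def)
  have x: "x i \<in> states e" if "i < card A" for i
    using y'(2,3)[OF hA[OF that]] a l[OF that]
    by (auto simp: x_def states_iff[OF e(1)] tr_scaleR l_def intro: positive_scaleR corner_scaleR)
  have reindex: "(\<Sum>i<card A. F (h i)) = (\<Sum>k\<in>A. F k)" for F :: "'k \<Rightarrow> 'c::comm_monoid_add"
    by (rule sum.reindex_bij_betw[OF h])
  have lsum: "(\<Sum>i<card A. l i) = 1" using reindex[of "\<lambda>k. tr (y k)"] y'(4) by (simp add: l_def)
  have xsum: "(\<Sum>i<card A. l i *\<^sub>R x i) = a" using lx reindex[of y] by (simp add: a_def)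
  have summand: "l i * entropy (\<Phi> e) (restrict \<Phi> (corner e) (x i)) = hom_entropy (\<Phi> (y (h i)))"
    if "i < card A" for i
  proof -
    have "positive (\<Phi> (x i))" using x[OF that] by (simp add: states_iff[OF e(1)] positive)
    then have "l i * hom_entropy (\<Phi> (x i)) = hom_entropy (l i *\<^sub>R \<Phi> (x i))"
      using l[OF that] by (simp add: hom_entropy_scaleR)
    also have "l i *\<^sub>R \<Phi> (x i) = \<Phi> (y (h i))" using lx[OF that] by (simp flip: map_scaleR)
    finally show ?thesis using entropy_map_state[OF e x[OF that]] by simp
  qed
  have "holevo A y = entropy (\<Phi> e) (restrict \<Phi> (corner e) a) -
      (\<Sum>i<card A. l i * entropy (\<Phi> e) (restrict \<Phi> (corner e) (x i)))"
    using summand reindex[of "\<lambda>k. hom_entropy (\<Phi> (y k))"] entropy_map_state[OF e a]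
    by (simp add: holevo_def a_def)
  then have "ereal (holevo A y) \<le> capacity_at e (\<Phi> e) (restrict \<Phi> (corner e)) a"
    unfolding capacity_at_def using l x lsum xsum by (intro Sup_upper) blast
  then show ?thesis unfolding capacity_def using a by (rule SUP_upper2[rotated])
qed

lemma capacity_le:
  assumes e: "projection e" "projection (\<Phi> e)"
    and c: "\<And>A y. ensemble e (A :: nat set) y \<Longrightarrow> holevo A y \<le> c"
  shows "corner_capacity e \<le> ereal c"
  unfolding capacity_def capacity_at_def
proof (intro SUP_least Sup_least, clarify)
  fix k :: nat and l :: "nat \<Rightarrow> real" and x
  assume lx: "\<forall>i<k. 0 \<le> l i \<and> x i \<in> states e" "(\<Sum>i<k. l i) = 1"
    and a: "(\<Sum>i<k. l i *\<^sub>R x i) \<in> states e"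
  have x: "positive (x i)" "x i \<in> corner e" "tr (x i) = 1" "0 \<le> l i" if "i < k" for i
    using lx(1) that by (auto simp: states_iff[OF e(1)])
  have "ensemble e {..<k} (\<lambda>i. l i *\<^sub>R x i)"
    using x lx(2) by (auto simp: ensemble_def tr_scaleR intro: positive_scaleR corner_scaleR)
  then have "holevo {..<k} (\<lambda>i. l i *\<^sub>R x i) \<le> c" by (rule c)
  moreover have "hom_entropy (\<Phi> (l i *\<^sub>R x i)) = l i * entropy (\<Phi> e) (restrict \<Phi> (corner e) (x i))"
    if "i < k" for i
    using x[OF that] entropy_map_state[OF e, of "x i"] lx(1) that
    by (simp add: map_scaleR hom_entropy_scaleR positive)
  ultimately show "ereal (entropy (\<Phi> e) (restrict \<Phi> (corner e) (\<Sum>i<k. l i *\<^sub>R x i)) -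
      (\<Sum>i<k. l i * entropy (\<Phi> e) (restrict \<Phi> (corner e) (x i)))) \<le> ereal c"
    by (simp add: holevo_def entropy_map_state[OF e a] del: restrict_apply)
qed

lemma corner_capacity_0: "corner_capacity 0 = - \<infinity>"
proof -
  have "states (0::'m) = {}" by (auto simp: states_iff corner_def)
  then show ?thesis by (simp add: capacity_def bot_ereal_def)
qed

lemma holevo_le_tr_one:
  assumes "ensemble e A y"
  shows "holevo A y \<le> tr (1::'p)"
proof -
  note y = ensembleD[OF assms]
  have "0 \<le> hom_entropy (\<Phi> (y k))" if k: "k \<in> A" for k
  proof (cases "tr (y k) = 0")
    case True
    then have "y k = 0" using tr_eq_0 y(2)[OF k] by blast
    then show ?thesis by simp
  next
    case False
    then have t: "tr (y k) > 0" using tr_nonneg[OF y(2)[OF k]] by simp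
    define z where "z = (1 / tr (y k)) *\<^sub>R \<Phi> (y k)"
    have z: "positive z" "tr z = 1"
      using t positive[OF y(2)[OF k]] by (simp_all add: z_def positive_scaleR tr_scaleR tr_map)
    have "\<Phi> (y k) = tr (y k) *\<^sub>R z" using t by (simp add: z_def)
    then have "hom_entropy (\<Phi> (y k)) = tr (y k) * hom_entropy z"
      using t by (simp add: hom_entropy_scaleR[OF z(1)])
    then show ?thesis using entropy_bounds(1)[OF z] z(2) t by (simp add: hom_entropy_tr_1)
  qed
  then have "holevo A y \<le> hom_entropy (\<Phi> (\<Sum>k\<in>A. y k))" by (simp add: holevo_def sum_nonneg)
  also have "\<dots> \<le> tr (1::'p)"
  proof -
    have "positive (\<Phi> (\<Sum>k\<in>A. y k))" by (intro positive positive_sum y(2))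
    moreover have "tr (\<Phi> (\<Sum>k\<in>A. y k)) = 1" by (simp add: tr_map tr_sum y(4))
    ultimately show ?thesis using entropy_bounds(2) by (simp add: hom_entropy_tr_1)
  qed
  finally show ?thesis .
qed

text \<open>Finite because the Holevo quantity is at most the trace of 1 in the target, while the
  single state proportional to \<open>e\<close> gives 0. The second clause supplies nearly optimal
  ensembles in place of maximizers.\<close>

lemma corner_capacity_real:
  assumes e: "projection e" "projection (\<Phi> e)" "e \<noteq> 0"
  obtains c where "corner_capacity e = ereal c"
    "\<And>\<epsilon>. \<epsilon> > 0 \<Longrightarrow> \<exists>A y. ensemble e (A :: nat set) y \<and> c - \<epsilon> < holevo A y"
proof -
  have t: "tr e > 0" using tr_projection_ge_1[OF e(1,3)] by simp
  define s where "s = (1 / tr e) *\<^sub>R e"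
  have "positive s" unfolding s_def using t by (intro positive_scaleR projection_positive e) simp
  then have s: "ensemble e {0::nat} (\<lambda>_. s)"
    using t e(1) by (simp add: ensemble_def s_def tr_scaleR corner_scaleR projection_in_corner)
  have "ereal 0 \<le> corner_capacity e"
    using holevo_le_capacity[OF e(1,2) s] by (simp add: holevo_def)
  moreover have "corner_capacity e \<le> ereal (tr (1::'p))"
    by (rule capacity_le[OF e(1,2) holevo_le_tr_one])
  ultimately obtain c where c: "corner_capacity e = ereal c" by (cases "corner_capacity e") auto
  show thesis
  proof (rule that[OF c])
    fix \<epsilon> :: real assume "\<epsilon> > 0"
    show "\<exists>A y. ensemble e (A :: nat set) y \<and> c - \<epsilon> < holevo A y"
    proof (rule ccontr)
      assume "\<not> ?thesis"
      then have "corner_capacity e \<le> ereal (c - \<epsilon>)" by (intro capacity_le[OF e(1,2)]) force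
      then show False using c \<open>\<epsilon> > 0\<close> by simp
    qed
  qed
qed

section \<open>Cutting ensembles into blocks and mixing ensembles of blocks\<close>

lemma holevo_scaleR:
  assumes "finite A" "\<And>k. k \<in> A \<Longrightarrow> positive (y k)" "0 \<le> w"
  shows "holevo A (\<lambda>k. w *\<^sub>R y k) = w * holevo A y"
proof -
  have "positive (\<Phi> (\<Sum>k\<in>A. y k))" by (intro positive positive_sum assms(2))
  then have "hom_entropy (\<Phi> (\<Sum>k\<in>A. w *\<^sub>R y k)) = w * hom_entropy (\<Phi> (\<Sum>k\<in>A. y k))"
    using assms(3) by (simp add: map_scaleR hom_entropy_scaleR flip: scaleR_sum_right)
  moreover have "(\<Sum>k\<in>A. hom_entropy (\<Phi> (w *\<^sub>R y k))) = w * (\<Sum>k\<in>A. hom_entropy (\<Phi> (y k)))"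
    using assms by (simp add: map_scaleR hom_entropy_scaleR positive sum_distrib_left)
  ultimately show ?thesis by (simp add: holevo_def right_diff_distrib)
qed

text \<open>By homogeneity, division by the total trace produces an ensemble; if that trace is 0,
  faithfulness makes every member 0.\<close>

lemma holevo_le_tr_mult_capacity:
  assumes e: "projection e" "projection (\<Phi> e)" and c: "corner_capacity e = ereal c"
    and y: "finite A" "\<And>k. k \<in> A \<Longrightarrow> positive (y k)" "\<And>k. k \<in> A \<Longrightarrow> y k \<in> corner e"
  shows "holevo A y \<le> (\<Sum>k\<in>A. tr (y k)) * c"
proof (cases "(\<Sum>k\<in>A. tr (y k)) = 0")
  case True
  then have "tr (y k) = 0" if "k \<in> A" for k
    using that y(1) sum_nonneg_eq_0_iff[of A "\<lambda>k. tr (y k)"] tr_nonneg[OF y(2)] by blast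
  then have "y k = 0" if "k \<in> A" for k using tr_eq_0 y(2) that by blast
  then show ?thesis using True by (simp add: holevo_def)
next
  case False
  define t where "t = (\<Sum>k\<in>A. tr (y k))"
  have t: "t > 0" using False tr_nonneg[OF y(2)] by (simp add: t_def order_less_le sum_nonneg)
  have "ensemble e A (\<lambda>k. (1 / t) *\<^sub>R y k)"
    using y t by (auto simp: ensemble_def tr_scaleR t_def corner_scaleR positive_scaleR simp flip: sum_divide_distrib)
  then have "holevo A (\<lambda>k. (1 / t) *\<^sub>R y k) \<le> c"
    using holevo_le_capacity[OF e] c by fastforce
  then show ?thesis using holevo_scaleR[of A y "1 / t"] y(1,2) t by (simp add: t_def field_simps)
qed

text \<open>Pinching bounds the entropy of the average from above, the compression inequality bounds
  each subtracted term from below. The \<open>eta\<close> terms are the gap between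
  \<open>entropy\<close> and \<open>hom_entropy\<close> on the blocks of the average.\<close>

lemma holevo_le_sum:
  assumes e: "finite I" "\<And>i. i \<in> I \<Longrightarrow> projection (e i)" "\<And>i. i \<in> I \<Longrightarrow> projection (\<Phi> (e i))"
    "(\<Sum>i\<in>I. e i) = 1"
    and y: "ensemble 1 A y"
  shows "holevo A y \<le> (\<Sum>i\<in>I. eta (\<Sum>k\<in>A. tr (e i * y k * e i)) + holevo A (\<lambda>k. e i * y k * e i))"
proof -
  note y' = ensembleD[OF y]
  define a where "a = (\<Sum>k\<in>A. y k)"
  have a: "positive a" "tr a = 1"
    using y' by (auto simp: a_def tr_sum intro: positive_sum)
  have "(\<Sum>i\<in>I. \<Phi> (e i)) = 1" using e(4) unital by (simp flip: map_sum)
  note f = orthogonal_projections_if_sum_eq_1[OF e(1,3) this] this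
  have comp: "e i * a * e i = (\<Sum>k\<in>A. e i * y k * e i)" for i
    by (simp add: a_def sum_distrib_left sum_distrib_right)
  have "hom_entropy (\<Phi> a) = entropy 1 (\<Phi> a)" using a by (simp add: hom_entropy_tr_1 tr_map)
  also have "\<dots> \<le> (\<Sum>i\<in>I. entropy 1 (\<Phi> (e i) * \<Phi> a * \<Phi> (e i)))"
    by (rule entropy_le_pinching[OF positive[OF a(1)] f])
  also have "\<dots> = (\<Sum>i\<in>I. entropy 1 (\<Phi> (e i * a * e i)))"
    using map_compress[OF e(2,3) a(1)] by simp
  also have "\<dots> = (\<Sum>i\<in>I. eta (\<Sum>k\<in>A. tr (e i * y k * e i)) + hom_entropy (\<Phi> (\<Sum>k\<in>A. e i * y k * e i)))"
    by (simp add: hom_entropy_def tr_map comp tr_sum)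
  finally have upper: "hom_entropy (\<Phi> a) \<le> \<dots>" .
  have lower: "(\<Sum>i\<in>I. hom_entropy (\<Phi> (e i * y k * e i))) \<le> hom_entropy (\<Phi> (y k))" if "k \<in> A" for k
    using sum_hom_entropy_compress_le[OF positive[OF y'(2)[OF that]] f] map_compress[OF e(2,3) y'(2)[OF that]]
    by simp
  have "(\<Sum>i\<in>I. \<Sum>k\<in>A. hom_entropy (\<Phi> (e i * y k * e i))) = (\<Sum>k\<in>A. \<Sum>i\<in>I. hom_entropy (\<Phi> (e i * y k * e i)))"
    by (rule sum.swap)
  also have "\<dots> \<le> (\<Sum>k\<in>A. hom_entropy (\<Phi> (y k)))" by (rule sum_mono[OF lower])
  finally show ?thesis using upper by (simp add: holevo_def a_def sum.distrib sum_subtractf)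
qed

text \<open>Members from different blocks have orthogonal images, so the entropy of the mixture
  splits exactly: the equality counterpart of \<open>holevo_le_sum\<close>.\<close>

lemma holevo_Sigma:
  assumes e: "finite J" "\<And>i. i \<in> J \<Longrightarrow> projection (e i)" "\<And>i. i \<in> J \<Longrightarrow> projection (\<Phi> (e i))"
    "orthogonal_projections J (\<lambda>i. \<Phi> (e i))"
    and w: "\<And>i. i \<in> J \<Longrightarrow> 0 \<le> w i" "(\<Sum>i\<in>J. w i) = 1"
    and y: "\<And>i. i \<in> J \<Longrightarrow> ensemble (e i) (A i) (y i)"
  shows "ensemble 1 (Sigma J A) (\<lambda>(i, k). w i *\<^sub>R y i k)"
    and "holevo (Sigma J A) (\<lambda>(i, k). w i *\<^sub>R y i k) = (\<Sum>i\<in>J. eta (w i) + w i * holevo (A i) (y i))"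
proof -
  have finA: "\<forall>i\<in>J. finite (A i)" using y by (simp add: ensemble_def)
  have pos: "positive (y i k)" if "i \<in> J" "k \<in> A i" for i k using ensembleD(2)[OF y] that by blast
  have "(\<Sum>x\<in>Sigma J A. tr (case x of (i, k) \<Rightarrow> w i *\<^sub>R y i k)) = (\<Sum>i\<in>J. \<Sum>k\<in>A i. w i * tr (y i k))"
    by (simp add: sum.Sigma[OF e(1) finA] split_def tr_scaleR)
  also have "\<dots> = 1" using ensembleD(4)[OF y] w(2) by (simp flip: sum_distrib_left)
  finally show ens: "ensemble 1 (Sigma J A) (\<lambda>(i, k). w i *\<^sub>R y i k)"
    using e(1) finA w(1) pos by (auto simp: ensemble_def intro: positive_scaleR)
  define a where "a i = (\<Sum>k\<in>A i. y i k)" for i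
  have a: "positive (a i)" "a i \<in> corner (e i)" "tr (a i) = 1" if "i \<in> J" for i
    using ensemble_sum_states[OF e(2)[OF that] y[OF that]] by (simp_all add: a_def states_iff[OF e(2)[OF that]])
  have suma: "(\<Sum>x\<in>Sigma J A. case x of (i, k) \<Rightarrow> w i *\<^sub>R y i k) = (\<Sum>i\<in>J. w i *\<^sub>R a i)"
    by (simp add: sum.Sigma[OF e(1) finA, symmetric] a_def scaleR_sum_right)
  have "hom_entropy (\<Phi> (\<Sum>i\<in>J. w i *\<^sub>R a i)) = entropy 1 (\<Sum>i\<in>J. w i *\<^sub>R \<Phi> (a i))"
    using a(3) w(2) by (simp add: hom_entropy_tr_1 map_sum map_scaleR tr_sum tr_scaleR tr_map)
  also have "\<dots> = (\<Sum>i\<in>J. entropy 1 (w i *\<^sub>R \<Phi> (a i)))"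
    by (rule entropy_orthogonal_sum[OF e(4)])
      (auto intro!: positive_scaleR positive corner_scaleR map_corner e a w)
  also have "\<dots> = (\<Sum>i\<in>J. eta (w i) + w i * hom_entropy (\<Phi> (a i)))"
    using a w(1) by (simp add: entropy_scaleR positive hom_entropy_tr_1 tr_map add.commute)
  finally have "hom_entropy (\<Phi> (\<Sum>i\<in>J. w i *\<^sub>R a i)) = \<dots>" .
  moreover have "(\<Sum>x\<in>Sigma J A. hom_entropy (\<Phi> (case x of (i, k) \<Rightarrow> w i *\<^sub>R y i k))) =
      (\<Sum>i\<in>J. w i * (\<Sum>k\<in>A i. hom_entropy (\<Phi> (y i k))))"
  proof -
    have "(\<Sum>x\<in>Sigma J A. hom_entropy (\<Phi> (case x of (i, k) \<Rightarrow> w i *\<^sub>R y i k))) =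
        (\<Sum>i\<in>J. \<Sum>k\<in>A i. hom_entropy (\<Phi> (w i *\<^sub>R y i k)))"
      by (simp add: sum.Sigma[OF e(1) finA] split_def)
    also have "\<dots> = (\<Sum>i\<in>J. \<Sum>k\<in>A i. w i * hom_entropy (\<Phi> (y i k)))"
      using pos w(1) by (intro sum.cong) (auto simp: map_scaleR hom_entropy_scaleR positive)
    finally show ?thesis by (simp add: sum_distrib_left)
  qed
  ultimately show "holevo (Sigma J A) (\<lambda>(i, k). w i *\<^sub>R y i k) = (\<Sum>i\<in>J. eta (w i) + w i * holevo (A i) (y i))"
    unfolding holevo_def suma by (simp add: a_def sum.distrib sum_subtractf right_diff_distrib)
qed

text \<open>Both inequalities compare with the weights \<open>w i = exp (C i) / Z\<close>, the maximizer of
  \<open>\<Sum>i. eta (w i) + w i * C i\<close> among probability vectors.\<close>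

lemma capacity_eq_ln_sum_exp:
  assumes e: "finite I" "\<And>i. i \<in> I \<Longrightarrow> projection (e i)" "\<And>i. i \<in> I \<Longrightarrow> projection (\<Phi> (e i))"
    "(\<Sum>i\<in>I. e i) = 1"
    and C: "\<And>i. i \<in> I \<Longrightarrow> e i \<noteq> 0 \<Longrightarrow> corner_capacity (e i) = ereal (C i)"
    and nz: "(1::'m) \<noteq> 0"
  shows "corner_capacity 1 = ereal (ln (\<Sum>i\<in>{i\<in>I. e i \<noteq> 0}. exp (C i)))"
    and "0 < (\<Sum>i\<in>{i\<in>I. e i \<noteq> 0}. exp (C i))"
proof -
  define J where "J = {i\<in>I. e i \<noteq> 0}"
  define Z where "Z = (\<Sum>i\<in>J. exp (C i))"
  define w where "w i = exp (C i) / Z" for i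
  have J: "finite J" "J \<subseteq> I" using e(1) by (auto simp: J_def)
  have "J \<noteq> {}"
  proof
    assume "J = {}"
    then have "(\<Sum>i\<in>I. e i) = 0" by (intro sum.neutral) (auto simp: J_def)
    then show False using e(4) nz by simp
  qed
  then have Z: "Z > 0" unfolding Z_def using J(1) by (intro sum_pos) auto
  then show "0 < (\<Sum>i\<in>{i\<in>I. e i \<noteq> 0}. exp (C i))" by (simp add: Z_def J_def)
  have w: "w i > 0" "ln (w i) = C i - ln Z" for i using Z by (simp_all add: w_def ln_div)
  have wsum: "(\<Sum>i\<in>J. w i) = 1" using Z by (simp add: w_def Z_def flip: sum_divide_distrib)
  have one: "projection (\<Phi> 1)" by (simp add: unital)
  obtain c where c: "corner_capacity 1 = ereal c"
    "\<And>\<epsilon>. \<epsilon> > 0 \<Longrightarrow> \<exists>A y. ensemble 1 (A :: nat set) y \<and> c - \<epsilon> < holevo A y"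
    using corner_capacity_real[OF projection_one one nz] by metis
  have "c \<le> ln Z"
  proof (rule field_le_epsilon)
    fix \<epsilon> :: real assume "\<epsilon> > 0"
    then obtain A y where y: "ensemble 1 (A :: nat set) y" "c - \<epsilon> < holevo A y" using c(2) by blast
    note y' = ensembleD[OF y(1)]
    define p where "p i = (\<Sum>k\<in>A. tr (e i * y k * e i))" for i
    have pos: "positive (e i * y k * e i)" if "i \<in> I" "k \<in> A" for i k
      by (intro positive_compress_projection y' e that)
    have p: "0 \<le> p i" if "i \<in> I" for i unfolding p_def by (intro sum_nonneg tr_nonneg pos that)
    have "(\<Sum>i\<in>J. p i) = (\<Sum>i\<in>I. p i)"
      by (rule sum.mono_neutral_left) (use e(1) in \<open>auto simp: J_def p_def\<close>)
    also have "\<dots> = (\<Sum>i\<in>I. \<Sum>k\<in>A. tr (y k * e i))"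
      unfolding p_def by (intro sum.cong refl tr_mult_projection[symmetric] e(2))
    also have "\<dots> = (\<Sum>k\<in>A. tr (y k * (\<Sum>i\<in>I. e i)))"
      by (subst sum.swap) (simp add: sum_distrib_left tr_sum)
    finally have psum: "(\<Sum>i\<in>J. p i) = 1" by (simp add: e(4) y'(4))
    have "holevo A y \<le> (\<Sum>i\<in>I. eta (p i) + holevo A (\<lambda>k. e i * y k * e i))"
      unfolding p_def by (rule holevo_le_sum[OF e y(1)])
    also have "\<dots> = (\<Sum>i\<in>J. eta (p i) + holevo A (\<lambda>k. e i * y k * e i))"
      by (rule sum.mono_neutral_right) (use e(1) in \<open>auto simp: J_def p_def holevo_def\<close>)
    \<comment> \<open>The tangent is taken at the optimal weight:
      \<open>ln (w i) = C i - ln Z\<close> cancels \<open>p i * C i\<close>, and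
      \<open>w i - p i\<close> sums to 0 because both are probability vectors.\<close>
    also have "\<dots> \<le> (\<Sum>i\<in>J. p i * ln Z + w i - p i)"
    proof (rule sum_mono)
      fix i assume "i \<in> J"
      then have i: "i \<in> I" "e i \<noteq> 0" by (auto simp: J_def)
      have "holevo A (\<lambda>k. e i * y k * e i) \<le> p i * C i"
        unfolding p_def
        by (rule holevo_le_tr_mult_capacity[OF e(2,3) C y'(1)]) (use i pos corner_compress in auto)
      moreover have "eta (p i) \<le> - p i * (C i - ln Z) + w i - p i"
        using eta_le_tangent[OF p[OF i(1)] w(1)] by (simp add: w(2))
      ultimately show "eta (p i) + holevo A (\<lambda>k. e i * y k * e i) \<le> p i * ln Z + w i - p i"
        by (simp add: algebra_simps)
    qed
    also have "\<dots> = ln Z"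
      by (simp add: sum.distrib sum_subtractf psum wsum flip: sum_distrib_right)
    finally show "c \<le> ln Z + \<epsilon>" using y(2) by simp
  qed
  moreover have "ln Z \<le> c"
  proof (rule field_le_epsilon)
    fix \<epsilon> :: real assume eps: "\<epsilon> > 0"
    have "\<exists>A y. ensemble (e i) (A :: nat set) y \<and> C i - \<epsilon> < holevo A y" if "i \<in> J" for i
    proof -
      have i: "i \<in> I" "e i \<noteq> 0" using that by (auto simp: J_def)
      show ?thesis
        using corner_capacity_real[OF e(2)[OF i(1)] e(3)[OF i(1)] i(2)] C[OF i] eps ereal.inject by metis
    qed
    then obtain A y where y: "\<And>i. i \<in> J \<Longrightarrow> ensemble (e i) (A i :: nat set) (y i)"
      "\<And>i. i \<in> J \<Longrightarrow> C i - \<epsilon> < holevo (A i) (y i)" by metis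
    have "(\<Sum>i\<in>I. \<Phi> (e i)) = 1" using e(4) unital by (simp flip: map_sum)
    from orthogonal_projections_if_sum_eq_1[OF e(1,3) this]
    have f: "orthogonal_projections J (\<lambda>i. \<Phi> (e i))"
      using J by (auto simp: orthogonal_projections_def)
    have eJ: "\<And>i. i \<in> J \<Longrightarrow> projection (e i)" "\<And>i. i \<in> J \<Longrightarrow> projection (\<Phi> (e i))"
      using e(2,3) J(2) by auto
    have w0: "0 \<le> w i" for i using w(1)[of i] by simp
    note comb = holevo_Sigma[OF J(1) eJ f w0 wsum y(1)]
    have "ln Z - \<epsilon> = (\<Sum>i\<in>J. w i * (ln Z - \<epsilon>))" using wsum by (simp flip: sum_distrib_right)
    \<comment> \<open>At the optimal weights each \<open>eta (w i) + w i * C i\<close> equals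
      \<open>w i * ln Z\<close>.\<close>
    also have "\<dots> = (\<Sum>i\<in>J. eta (w i) + w i * (C i - \<epsilon>))"
      unfolding eta_def w(2) using w(1) by (simp add: algebra_simps)
    also have "\<dots> \<le> (\<Sum>i\<in>J. eta (w i) + w i * holevo (A i) (y i))"
      using y(2) w0 by (intro sum_mono add_left_mono mult_left_mono) (auto intro: less_imp_le)
    also have "\<dots> \<le> c"
      using holevo_le_capacity[OF projection_one one comb(1)] comb(2) c(1) by simp
    finally show "ln Z \<le> c + \<epsilon>" by simp
  qed
  ultimately show "corner_capacity 1 = ereal (ln (\<Sum>i\<in>{i\<in>I. e i \<noteq> 0}. exp (C i)))"
    using c(1) by (simp add: Z_def J_def)
qed

end

theorem theorem3:
  fixes \<Phi> :: "'m::fd_cstar_algebra \<Rightarrow> 'p::fd_cstar_algebra"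
    and e :: "nat \<Rightarrow> 'm"
    and n :: nat
  assumes "Vector_Spaces.linear scaleC scaleC \<Phi>"
    and "\<forall>x. positive_in 1 x \<longrightarrow> positive_in 1 (\<Phi> x)"
    and "\<Phi> 1 = 1"
    and "\<forall>x. Tr 1 (\<Phi> x) = Tr 1 x"
    and "\<forall>i\<in>{1..n}. projection (e i)"
    and "(\<Sum>i=1..n. e i) = 1"
    and "\<forall>i\<in>{1..n}. projection (\<Phi> (e i))"
  shows "capacity 1 1 \<Phi> =
    log_ereal (\<Sum>i=1..n. exp_ereal (capacity (e i) (\<Phi> (e i)) (restrict \<Phi> (corner (e i)))))"
proof -
  interpret positive_trace_preserving \<Phi>
    by (rule positive_trace_preserving.intro) (use assms(1-4) in auto)
  have proj: "projection (e i)" "projection (\<Phi> (e i))" if "i \<in> {1..n}" for i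
    using assms(5,7) that by auto
  have whole: "corner_capacity 1 = capacity 1 1 \<Phi>" by (simp add: assms(3) restrict_def)
  have zero: "exp_ereal (corner_capacity 0) = 0"
    using corner_capacity_0 by (simp add: exp_ereal.simps(3)[unfolded MInfty_eq_minfinity])
  show ?thesis
  \<comment> \<open>The zero algebra has no states: all capacities are \<open>- \<infinity>\<close>,
    which \<open>exp_ereal\<close> sends to 0 and \<open>log_ereal\<close> sends back. This case
    covers \<open>n = 0\<close>.\<close>
  proof (cases "(1::'m) = 0")
    case True
    then have "e i = 0" for i by (metis mult_1_right mult_zero_right)
    moreover have "corner_capacity 1 = - \<infinity>" using True corner_capacity_0 by simp
    ultimately show ?thesis using zero whole by (simp add: zero_ereal_def)
  next
    case False
    have "\<exists>c. e i \<noteq> 0 \<longrightarrow> corner_capacity (e i) = ereal c" if "i \<in> {1..n}" for i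
      using corner_capacity_real[OF proj[OF that]] by metis
    then obtain C where C: "\<And>i. i \<in> {1..n} \<Longrightarrow> e i \<noteq> 0 \<Longrightarrow> corner_capacity (e i) = ereal (C i)"
      by metis
    define J where "J = {i\<in>{1..n}. e i \<noteq> 0}"
    note cap = capacity_eq_ln_sum_exp[OF _ proj assms(6) C False, folded J_def, simplified]
    have "(\<Sum>i=1..n. exp_ereal (corner_capacity (e i))) = (\<Sum>i\<in>J. exp_ereal (corner_capacity (e i)))"
      by (rule sum.mono_neutral_right) (use zero in \<open>auto simp: J_def\<close>)
    also have "\<dots> = (\<Sum>i\<in>J. ereal (exp (C i)))" using C by (intro sum.cong) (auto simp: J_def)
    also have "\<dots> = ereal (\<Sum>i\<in>J. exp (C i))" by simp
    finally show ?thesis using cap whole by simp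
  qed
qed

end
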